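(* Let two parabolas in the Euclidean plane meet in four distinct points, and consider the parabolic quadrilateral formed by them. There exists a circle tangent to all four sides of this parabolic quadrilateral if and only if its diagonals are perpendicular.
   Context: A parabolic quadrilateral is the figure that is the intersection of two parts of the plane, each bounded by a parabola (the part bounded by a parabola is the convex region consisting of the parabola and its inside, i.e. the side containing the focus), where the two parabolas meet in four distinct points. Its vertices are these four points. Its sides are the four arcs of the parabolas that make up its boundary, each joining two consecutive vertices. Its diagonals are the two straight segments joining opposite vertices, i.e. the diagonals of the convex quadrilateral with the same four vertices. *)

theory Defs
  imports "HOL-Analysis.Analysis"
begin

type_synonym point = "real^2"

definition is_line :: "point set \<Rightarrow> bool" where
  "is_line L \<longleftrightarrow> affine L \<and> aff_dim L = 1"

text \<open>A parabola is given by its focus F and its directrix d, a line not through F.\<close>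

definition parabola :: "point \<Rightarrow> point set \<Rightarrow> point set" where
  "parabola F d = {X. dist X F = infdist X d}"

definition parabolic_region :: "point \<Rightarrow> point set \<Rightarrow> point set" where
  "parabolic_region F d = {X. dist X F \<le> infdist X d}"

definition pq_region :: "point \<Rightarrow> point set \<Rightarrow> point \<Rightarrow> point set \<Rightarrow> point set" where
  "pq_region F1 d1 F2 d2 = parabolic_region F1 d1 \<inter> parabolic_region F2 d2"

definition pq_vertices :: "point \<Rightarrow> point set \<Rightarrow> point \<Rightarrow> point set \<Rightarrow> point set" where
  "pq_vertices F1 d1 F2 d2 = parabola F1 d1 \<inter> parabola F2 d2"

text \<open>A side path runs along one of the two parabolas, inside the boundary of the
  quadrilateral, and contains no vertices other than its two endpoints (which are
  distinct because the path is an arc, i.e. injective).\<close>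

definition pq_side_path ::
    "point \<Rightarrow> point set \<Rightarrow> point \<Rightarrow> point set \<Rightarrow> (real \<Rightarrow> point) \<Rightarrow> bool" where
  "pq_side_path F1 d1 F2 d2 g \<longleftrightarrow>
     arc g \<and>
     (path_image g \<subseteq> parabola F1 d1 \<or> path_image g \<subseteq> parabola F2 d2) \<and>
     path_image g \<subseteq> frontier (pq_region F1 d1 F2 d2) \<and>
     path_image g \<inter> pq_vertices F1 d1 F2 d2 = {pathstart g, pathfinish g}"

definition pq_sides :: "point \<Rightarrow> point set \<Rightarrow> point \<Rightarrow> point set \<Rightarrow> point set set" where
  "pq_sides F1 d1 F2 d2 = {path_image g | g. pq_side_path F1 d1 F2 d2 g}"

definition pq_consecutive ::
    "point \<Rightarrow> point set \<Rightarrow> point \<Rightarrow> point set \<Rightarrow> point \<Rightarrow> point \<Rightarrow> bool" where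
  "pq_consecutive F1 d1 F2 d2 A B \<longleftrightarrow>
     (\<exists>g. pq_side_path F1 d1 F2 d2 g \<and> pathstart g = A \<and> pathfinish g = B)"

definition pq_opposite ::
    "point \<Rightarrow> point set \<Rightarrow> point \<Rightarrow> point set \<Rightarrow> point \<Rightarrow> point \<Rightarrow> bool" where
  "pq_opposite F1 d1 F2 d2 A C \<longleftrightarrow>
     A \<in> pq_vertices F1 d1 F2 d2 \<and> C \<in> pq_vertices F1 d1 F2 d2 \<and> A \<noteq> C \<and>
     \<not> pq_consecutive F1 d1 F2 d2 A C"

definition pq_diagonals :: "point \<Rightarrow> point set \<Rightarrow> point \<Rightarrow> point set \<Rightarrow> point set set" where
  "pq_diagonals F1 d1 F2 d2 =
     {closed_segment A C | A C. pq_opposite F1 d1 F2 d2 A C}"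

text \<open>L is the tangent line of the curve S at p: the distance to L of a point X of S
  is o(dist X p) as X tends to p along S. Requiring p to be a limit point of S keeps
  this from being vacuous and makes L unique. At an endpoint of an arc this is the
  one-sided tangent.\<close>

definition tangent_line_at :: "point set \<Rightarrow> point \<Rightarrow> point set \<Rightarrow> bool" where
  "tangent_line_at S p L \<longleftrightarrow>
     is_line L \<and> p \<in> L \<and> p \<in> S \<and> p islimpt S \<and>
     ((\<lambda>X. infdist X L / dist X p) \<longlongrightarrow> 0) (at p within S)"

definition tangent_curves :: "point set \<Rightarrow> point set \<Rightarrow> bool" where
  "tangent_curves S T \<longleftrightarrow> (\<exists>p L. tangent_line_at S p L \<and> tangent_line_at T p L)"

end

(*
  Let u1, u2 be unit vectors along the axes, and normalise the equations p1, p2 of the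
  parabolas (pi <= 0 inside) so that their quadratic parts have trace 1. A circle
  S = |X - c|^2 - r^2 that touches the parabola pi = 0 twice satisfies S = pi + Li^2 with
  Li affine of gradient ui. If it touches both parabolas twice, then
  p1 - p2 = (L2 - L1) (L2 + L1), so the four vertices lie on two lines with the normals
  u2 - u1 and u2 + u1, which are perpendicular; where the points of contact lie on the sides
  decides the signs of L1 and L2 at the vertices and shows that these lines are the diagonals.
  Conversely, if the diagonals are perpendicular, the conic p1 + L1^2 = p2 + L2^2 that they
  determine is a circle, and the signs of L1 at the vertices put a zero of L1 on each side.

  The calculation uses the affine coordinates in which the parabolas are y = k x^2 + m and
  x = l y^2 + n. The metric enters only through e1 . e1 = e2 . e2 for the coordinate vectors,
  and the diagonals are perpendicular iff their slopes are 1 and -1.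
*)

theory Submission imports Defs begin

section \<open>Lines, tangent lines and the normal form of a parabola\<close>

lemma inner_point: "(x::point) \<bullet> y = x$1 * y$1 + x$2 * y$2"
  by (simp add: inner_vec_def sum_2)

lemma point_eq_iff: "(x::point) = y \<longleftrightarrow> x$1 = y$1 \<and> x$2 = y$2"
  by (simp add: vec_eq_iff forall_2)

definition perp :: "point \<Rightarrow> point" where "perp u = vector [- (u$2), u$1]"

lemma perp_nth [simp]: "perp u $ 1 = - (u$2)" "perp u $ 2 = u$1"
  by (simp_all add: perp_def)

lemma is_line_normal_form:
  assumes "is_line L"
  obtains n q where "norm n = 1" "L = {X. n \<bullet> X = q}"
proof -
  \<comment> \<open>In the plane dimension 1 is codimension 1, the form that
    \<open>aff_dim_eq_hyperplane\<close> asks for.\<close>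
  have L: "affine hull L = L" and dim: "aff_dim L = int (DIM(point) - 1)"
    using assms unfolding is_line_def by (simp_all only: affine_hull_eq) simp
  obtain a b where ab: "a \<noteq> 0" "L = {X. a \<bullet> X = b}"
    using iffD1[OF aff_dim_eq_hyperplane dim] unfolding L by blast
  have "L = {X. (a /\<^sub>R norm a) \<bullet> X = b / norm a}"
    using ab by (auto simp: field_simps)
  moreover have "norm (a /\<^sub>R norm a) = 1" using ab by simp
  ultimately show thesis using that by blast
qed

lemma is_line_hyperplane:
  assumes "n \<noteq> (0::point)"
  shows "is_line {X. n \<bullet> (X - p) = 0}"
proof -
  have "{X. n \<bullet> (X - p) = 0} = {X. n \<bullet> X = n \<bullet> p}"
    by (auto simp: inner_diff_right)
  then show ?thesis
    using assms by (simp add: is_line_def affine_hyperplane aff_dim_hyperplane)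
qed

text \<open>The foot \<open>?Y\<close> of the perpendicular attains the value, and Cauchy-Schwarz
  shows that no point of the hyperplane is nearer.\<close>

lemma infdist_hyperplane:
  fixes n :: "'a::euclidean_space"
  assumes "norm n = 1"
  shows "infdist X {Y. n \<bullet> Y = q} = \<bar>n \<bullet> X - q\<bar>"
proof (rule antisym)
  let ?Y = "X - (n \<bullet> X - q) *\<^sub>R n"
  have nn: "n \<bullet> n = 1" using assms by (simp add: norm_eq_1)
  have "?Y \<in> {Y. n \<bullet> Y = q}" using nn by (simp add: inner_diff_right)
  then have "infdist X {Y. n \<bullet> Y = q} \<le> dist X ?Y" by (rule infdist_le)
  also have "\<dots> = \<bar>n \<bullet> X - q\<bar>" using assms by (simp add: dist_norm)
  finally show "infdist X {Y. n \<bullet> Y = q} \<le> \<bar>n \<bullet> X - q\<bar>" .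
  have ne: "{Y. n \<bullet> Y = q} \<noteq> {}" using \<open>?Y \<in> _\<close> by blast
  have "\<bar>n \<bullet> X - q\<bar> \<le> dist X Y" if "n \<bullet> Y = q" for Y
    using Cauchy_Schwarz_ineq2[of n "X - Y"] that assms
    by (simp add: inner_diff_right dist_norm)
  then show "\<bar>n \<bullet> X - q\<bar> \<le> infdist X {Y. n \<bullet> Y = q}"
    unfolding infdist_notempty[OF ne] by (intro cINF_greatest ne) auto
qed

text \<open>\<open>u\<close> is the unit normal of the directrix pointing towards the focus,
  \<open>h\<close> the distance from the focus to the directrix and \<open>V\<close> the vertex. In
  the squared focal condition the squares of the coordinate along \<open>u\<close> cancel.\<close>

lemma parabola_normal_form:
  assumes "is_line d" "F \<notin> d"
  obtains u V h where "norm u = 1" "h > 0"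
    "parabolic_region F d = {X. (perp u \<bullet> (X - V))\<^sup>2 \<le> 2 * h * (u \<bullet> (X - V))}"
    "parabola F d = {X. (perp u \<bullet> (X - V))\<^sup>2 = 2 * h * (u \<bullet> (X - V))}"
proof -
  obtain n q where n: "norm n = 1" "d = {X. n \<bullet> X = q}"
    using is_line_normal_form assms(1) by blast
  have "\<exists>u q. norm u = 1 \<and> d = {X. u \<bullet> X = q} \<and> u \<bullet> F > q"
  proof (cases "n \<bullet> F > q")
    case False
    then have "(- n) \<bullet> F > - q" using n assms(2) by auto
    then show ?thesis using n by (intro exI[of _ "- n"] exI[of _ "- q"]) auto
  qed (use n in blast)
  then obtain u q where u: "norm u = 1" "d = {X. u \<bullet> X = q}" "u \<bullet> F > q" by blast
  define h where "h = u \<bullet> F - q"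
  define V where "V = F - (h / 2) *\<^sub>R u"
  have uu: "u$1 * u$1 + u$2 * u$2 = 1" using u(1) by (simp add: norm_eq_1 inner_point)
  have id: "(X - F) \<bullet> (X - F) - (u \<bullet> X - q)\<^sup>2
      = (perp u \<bullet> (X - V))\<^sup>2 - 2 * h * (u \<bullet> (X - V))" for X
  proof -
    have pv: "perp u \<bullet> (X - V) = perp u \<bullet> (X - F)"
      by (simp add: V_def inner_point algebra_simps)
    have uv: "u \<bullet> (X - V) = u \<bullet> (X - F) + h / 2"
      using u(1) by (simp add: V_def inner_diff_right norm_eq_1)
    have uq: "u \<bullet> X - q = u \<bullet> (X - F) + h"
      by (simp add: h_def inner_diff_right)
    \<comment> \<open>The factor |u|^2 = 1 turns the splitting along \<open>perp u\<close> and
      \<open>u\<close> into a polynomial identity.\<close>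
    have "(X - F) \<bullet> (X - F) = ((X - F) \<bullet> (X - F)) * (u$1 * u$1 + u$2 * u$2)"
      using uu by simp
    also have "\<dots> = (perp u \<bullet> (X - F))\<^sup>2 + (u \<bullet> (X - F))\<^sup>2"
      by (simp add: inner_point power2_eq_square algebra_simps)
    finally show ?thesis unfolding pv uv uq by (simp add: power2_eq_square algebra_simps)
  qed
  have d2: "(dist X F)\<^sup>2 = (X - F) \<bullet> (X - F)" "(infdist X d)\<^sup>2 = (u \<bullet> X - q)\<^sup>2" for X
    using infdist_hyperplane[OF u(1), of X q] u(2) by (simp_all add: dist_norm power2_norm_eq_inner)
  show thesis
  proof (rule that[of u h V])
    have "dist X F \<le> infdist X d \<longleftrightarrow> (dist X F)\<^sup>2 \<le> (infdist X d)\<^sup>2" for X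
      by (simp add: abs_le_square_iff[symmetric] infdist_nonneg)
    then show "parabolic_region F d = {X. (perp u \<bullet> (X - V))\<^sup>2 \<le> 2 * h * (u \<bullet> (X - V))}"
      unfolding parabolic_region_def using id d2 by (metis (no_types, lifting) diff_le_0_iff_le)
    have "dist X F = infdist X d \<longleftrightarrow> (dist X F)\<^sup>2 = (infdist X d)\<^sup>2" for X
      by (simp add: power2_eq_iff_nonneg infdist_nonneg)
    then show "parabola F d = {X. (perp u \<bullet> (X - V))\<^sup>2 = 2 * h * (u \<bullet> (X - V))}"
      unfolding parabola_def using id d2 by (metis (no_types, lifting) eq_iff_diff_eq_0)
  qed (use u in \<open>auto simp: h_def\<close>)
qed

text \<open>Two lines through p with different directions bound \<open>dist X p\<close> by the sum of the
  distances of X to them, so both distances cannot be \<open>o(dist X p)\<close>.\<close>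

lemma tangent_line_unique:
  assumes "tangent_line_at S p L" "tangent_line_at S p M"
  shows "L = M"
proof -
  obtain a q where a: "norm a = 1" "L = {X. a \<bullet> X = q}"
    using is_line_normal_form assms(1) unfolding tangent_line_at_def by blast
  obtain b r where b: "norm b = 1" "M = {X. b \<bullet> X = r}"
    using is_line_normal_form assms(2) unfolding tangent_line_at_def by blast
  have p: "a \<bullet> p = q" "b \<bullet> p = r" "p islimpt S"
    using assms a b unfolding tangent_line_at_def by auto
  have la: "infdist X L = \<bar>a \<bullet> (X - p)\<bar>" and lb: "infdist X M = \<bar>b \<bullet> (X - p)\<bar>" for X
    using infdist_hyperplane a b p by (simp_all add: inner_diff_right)
  \<comment> \<open>The determinant of the two normals; \<open>bound\<close> is Cramer's rule for
    \<open>Z\<close>, with the entries of the unit normals estimated by 1.\<close>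
  define D where "D = a$1 * b$2 - a$2 * b$1"
  have bound: "\<bar>D\<bar> * norm Z \<le> 2 * (\<bar>a \<bullet> Z\<bar> + \<bar>b \<bullet> Z\<bar>)" for Z
  proof -
    have c: "\<bar>a$i\<bar> \<le> 1" "\<bar>b$i\<bar> \<le> 1" for i
      using a(1) b(1) component_le_norm_cart[of a i] component_le_norm_cart[of b i] by auto
    have "D * Z$1 = (a \<bullet> Z) * b$2 - (b \<bullet> Z) * a$2" "D * Z$2 = (b \<bullet> Z) * a$1 - (a \<bullet> Z) * b$1"
      by (simp_all add: D_def inner_point algebra_simps)
    moreover have "\<bar>(a \<bullet> Z) * b$i\<bar> \<le> \<bar>a \<bullet> Z\<bar>" "\<bar>(b \<bullet> Z) * a$i\<bar> \<le> \<bar>b \<bullet> Z\<bar>" for i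
      using c by (simp_all add: abs_mult mult_left_le)
    ultimately have "\<bar>D * Z$1\<bar> \<le> \<bar>a \<bullet> Z\<bar> + \<bar>b \<bullet> Z\<bar>" "\<bar>D * Z$2\<bar> \<le> \<bar>a \<bullet> Z\<bar> + \<bar>b \<bullet> Z\<bar>"
      by (smt (verit))+
    moreover have "norm Z \<le> \<bar>Z$1\<bar> + \<bar>Z$2\<bar>"
      using norm_le_l1_cart[of Z] by (simp add: sum_2)
    then have "\<bar>D\<bar> * norm Z \<le> \<bar>D\<bar> * (\<bar>Z$1\<bar> + \<bar>Z$2\<bar>)"
      by (rule mult_left_mono) simp
    then have "\<bar>D\<bar> * norm Z \<le> \<bar>D * Z$1\<bar> + \<bar>D * Z$2\<bar>"
      by (simp add: abs_mult distrib_left)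
    ultimately show ?thesis by (smt (verit, best) mult_2)
  qed
  have "D = 0"
  proof (rule ccontr)
    assume "D \<noteq> 0"
    have "((\<lambda>X. 2 * (infdist X L / dist X p + infdist X M / dist X p)) \<longlongrightarrow> 2 * (0 + 0))
      (at p within S)"
      using assms unfolding tangent_line_at_def by (intro tendsto_intros) auto
    then have "\<forall>\<^sub>F X in at p within S.
        2 * (infdist X L / dist X p + infdist X M / dist X p) < \<bar>D\<bar>"
      using \<open>D \<noteq> 0\<close> by (intro order_tendstoD(2)) auto
    moreover have "\<forall>\<^sub>F X in at p within S. X \<noteq> p" by (simp add: eventually_at_filter)
    ultimately have "\<forall>\<^sub>F X in at p within S. False"
    proof eventually_elim
      case (elim X)
      have "\<bar>D\<bar> * dist X p \<le> 2 * (infdist X L + infdist X M)"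
        using bound[of "X - p"] by (simp add: la lb dist_norm)
      then show False using elim by (simp add: field_simps)
    qed
    then show False using p(3) by (simp add: eventually_False trivial_limit_within)
  qed
  have aa: "a$1 * a$1 + a$2 * a$2 = 1" and bb: "b$1 * b$1 + b$2 * b$2 = 1"
    using a b by (simp_all add: norm_eq_1 inner_point)
  define s where "s = a \<bullet> b"
  have "s * a$1 = b$1" "s * a$2 = b$2"
    using aa \<open>D = 0\<close> unfolding s_def D_def inner_point by algebra+
  then have ba: "b = s *\<^sub>R a" by (simp add: point_eq_iff)
  then have "s \<noteq> 0" using b(1) by auto
  then show ?thesis unfolding a b using p(1,2) ba by auto
qed

text \<open>A quadratic bound makes the quotient of the distances at most a constant times
  \<open>dist X p\<close>, which tends to 0. Circles and parabolic arcs both provide such a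
  bound.\<close>

lemma tangent_line_atI:
  assumes n: "n \<noteq> 0" and p: "p \<in> S" "p islimpt S"
    and est: "\<And>X. X \<in> S \<Longrightarrow> \<bar>n \<bullet> (X - p)\<bar> \<le> K * (norm (X - p))\<^sup>2"
  shows "tangent_line_at S p {X. n \<bullet> (X - p) = 0}"
proof -
  let ?L = "{X. n \<bullet> (X - p) = 0}"
  have L: "?L = {X. (n /\<^sub>R norm n) \<bullet> X = (n /\<^sub>R norm n) \<bullet> p}"
    using n by (auto simp: inner_diff_right)
  have "infdist X ?L = \<bar>n \<bullet> (X - p)\<bar> / norm n" for X
    unfolding L using n
    by (subst infdist_hyperplane) (auto simp: inner_diff_right diff_divide_distrib[symmetric] field_simps)
  then have le: "infdist X ?L / dist X p \<le> K / norm n * dist X p" if "X \<in> S" "X \<noteq> p" for X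
    using est[OF that(1)] that(2) n by (simp add: dist_norm divide_simps power2_eq_square mult_ac)
  have "((\<lambda>X. infdist X ?L / dist X p) \<longlongrightarrow> 0) (at p within S)"
  proof (rule tendsto_sandwich[where f = "\<lambda>_. 0" and h = "\<lambda>X. K / norm n * dist X p"])
    have "((\<lambda>X. K / norm n * dist X p) \<longlongrightarrow> K / norm n * dist p p) (at p within S)"
      by (intro tendsto_intros)
    then show "((\<lambda>X. K / norm n * dist X p) \<longlongrightarrow> 0) (at p within S)" by simp
    show "\<forall>\<^sub>F X in at p within S. 0 \<le> infdist X ?L / dist X p"
      by (simp add: infdist_nonneg)
    show "\<forall>\<^sub>F X in at p within S. infdist X ?L / dist X p \<le> K / norm n * dist X p"
      using le by (auto simp: eventually_at_filter)
  qed simp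
  then show ?thesis using p n by (simp add: tangent_line_at_def is_line_hyperplane)
qed

text \<open>Two points \<open>p\<close> and \<open>X\<close> at the same distance from
  \<open>c\<close> satisfy \<open>(p - c) \<bullet> (X - p) = - (1/2) * (norm (X - p))^2\<close>
  exactly.\<close>

lemma tangent_line_sphere:
  fixes c :: point
  assumes "r > 0" "p \<in> sphere c r"
  shows "tangent_line_at (sphere c r) p {X. (p - c) \<bullet> (X - p) = 0}"
proof (rule tangent_line_atI[where K = "1/2"])
  show "p - c \<noteq> 0" using assms by auto
  \<comment> \<open>A connected set with a second point, here the antipode of \<open>p\<close>, has
    no isolated points.\<close>
  have "connected (sphere c r)" by (intro connected_sphere) simp
  moreover have "c - (p - c) \<in> sphere c r"
    using assms by (simp add: dist_norm norm_minus_commute)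
  moreover have "c - (p - c) \<noteq> p"
  proof
    assume "c - (p - c) = p"
    then have "2 *\<^sub>R (p - c) = 0" by (simp add: scaleR_2 algebra_simps)
    then show False using assms by auto
  qed
  ultimately show "p islimpt sphere c r"
    using assms(2) by (metis connected_imp_perfect singletonD)
  fix X assume "X \<in> sphere c r"
  then have "(X - c) \<bullet> (X - c) = r\<^sup>2" "(p - c) \<bullet> (p - c) = r\<^sup>2"
    using assms by (auto simp: dist_norm norm_minus_commute power2_norm_eq_inner[symmetric])
  then have "(p - c) \<bullet> (X - p) = - (1/2) * (norm (X - p))\<^sup>2"
    by (simp add: power2_norm_eq_inner inner_diff_left inner_diff_right inner_commute field_simps)
  then show "\<bar>(p - c) \<bullet> (X - p)\<bar> \<le> 1/2 * (norm (X - p))\<^sup>2" by simp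
qed (use assms in auto)

lemma pq_side_path_commute: "pq_side_path F2 d2 F1 d1 g \<longleftrightarrow> pq_side_path F1 d1 F2 d2 g"
proof -
  have "pq_region F2 d2 F1 d1 = pq_region F1 d1 F2 d2"
    "pq_vertices F2 d2 F1 d1 = pq_vertices F1 d1 F2 d2"
    by (simp_all only: pq_region_def pq_vertices_def Int_commute)
  then show ?thesis by (simp only: pq_side_path_def disj_commute)
qed

lemma pq_side_path_reversepath:
  assumes "pq_side_path F1 d1 F2 d2 g"
  shows "pq_side_path F1 d1 F2 d2 (reversepath g)"
  using assms unfolding pq_side_path_def path_image_reversepath pathstart_reversepath
    pathfinish_reversepath by (metis arc_reversepath insert_commute)

lemma closed_parabolic_region: "closed (parabolic_region F d)"
  unfolding parabolic_region_def
  by (intro closed_Collect_le continuous_on_dist continuous_on_infdist continuous_on_id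
      continuous_on_const)

section \<open>Quartics\<close>

text \<open>Subtracting the multiple of the monic product cancels the coefficient of degree 4; the
  remainder has degree at most 3 and four roots, so it is 0.\<close>

lemma quartic_with_four_roots:
  fixes p :: "real poly"
  assumes "degree p \<le> 4" "poly p a = 0" "poly p b = 0" "poly p c = 0" "poly p d = 0"
    and "a < b" "b < c" "c < d"
  shows "p = smult (coeff p 4) ([:-a, 1:] * [:-b, 1:] * [:-c, 1:] * [:-d, 1:])"
proof -
  define q where "q = [:-a, 1:] * [:-b, 1:] * [:-c, 1:] * [:-d, 1:]"
  define r where "r = p - smult (coeff p 4) q"
  have q: "degree q \<le> 4" "coeff q 4 = 1" by (simp_all add: q_def numeral_eq_Suc)
  have "poly q a = 0" "poly q b = 0" "poly q c = 0" "poly q d = 0"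
    by (simp_all add: q_def del: mult_pCons_left mult_pCons_right)
  then have root: "poly r a = 0" "poly r b = 0" "poly r c = 0" "poly r d = 0"
    using assms by (simp_all add: r_def)
  have deg: "degree r \<le> 4"
    unfolding r_def using assms(1) q(1) by (intro degree_diff_le order_trans[OF degree_smult_le])
  have r4: "coeff r 4 = 0" by (simp add: r_def q)
  have "r = 0"
  proof (rule ccontr)
    assume r: "r \<noteq> 0"
    then have "degree r \<noteq> 4" using r4 leading_coeff_neq_0 by metis
    have "card {a, b, c, d} \<le> card {x. poly r x = 0}"
      using root by (intro card_mono poly_roots_finite[OF r]) auto
    then show False
      using card_poly_roots_bound[OF r] deg \<open>degree r \<noteq> 4\<close> assms(6-8) by simp
  qed
  then show ?thesis by (simp add: r_def q_def)
qed

text \<open>The quartic and its derivative vanish at \<open>\<alpha>\<close> and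
  \<open>\<beta>\<close>. Subtracting \<open>A * ((t - \<alpha>) * (t - \<beta>))^2\<close> leaves a
  polynomial of degree at most 3 with two double roots, which must be 0.\<close>

lemma quartic_double_roots:
  fixes A :: real
  assumes "\<alpha> \<noteq> \<beta>"
    and "A * \<alpha>^4 + B * \<alpha>^3 + C * \<alpha>^2 + D * \<alpha> + G = 0" "A * \<beta>^4 + B * \<beta>^3 + C * \<beta>^2 + D * \<beta> + G = 0"
    and "4 * A * \<alpha>^3 + 3 * B * \<alpha>^2 + 2 * C * \<alpha> + D = 0" "4 * A * \<beta>^3 + 3 * B * \<beta>^2 + 2 * C * \<beta> + D = 0"
  shows "B = - 2 * A * (\<alpha> + \<beta>)"
    and "A * t^4 + B * t^3 + C * t^2 + D * t + G = A * ((t - \<alpha>) * (t - \<beta>))^2"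
proof -
  define b where "b = B + 2 * A * (\<alpha> + \<beta>)"
  define c where "c = C - A * ((\<alpha> + \<beta>)^2 + 2 * \<alpha> * \<beta>)"
  define d where "d = D + 2 * A * \<alpha> * \<beta> * (\<alpha> + \<beta>)"
  define e where "e = G - A * (\<alpha> * \<beta>)^2"
  have eq: "A * t^4 + B * t^3 + C * t^2 + D * t + G
      = A * ((t - \<alpha>) * (t - \<beta>))^2 + (b * t^3 + c * t^2 + d * t + e)" for t
    by (simp add: b_def c_def d_def e_def power4_eq_xxxx power3_eq_cube power2_eq_square algebra_simps)
  have q: "b * \<alpha>^3 + c * \<alpha>^2 + d * \<alpha> + e = 0" "b * \<beta>^3 + c * \<beta>^2 + d * \<beta> + e = 0"
    using eq[of \<alpha>] eq[of \<beta>] assms by simp_all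
  have "4 * A * t^3 + 3 * B * t^2 + 2 * C * t + D
      = A * (2 * (t - \<alpha>) * (t - \<beta>) * (2 * t - \<alpha> - \<beta>)) + (3 * b * t^2 + 2 * c * t + d)" for t
    by (simp add: b_def c_def d_def e_def power3_eq_cube power2_eq_square algebra_simps)
  from this[of \<alpha>] this[of \<beta>]
  have q': "3 * b * \<alpha>^2 + 2 * c * \<alpha> + d = 0" "3 * b * \<beta>^2 + 2 * c * \<beta> + d = 0"
    using assms by simp_all
  have "(\<alpha> - \<beta>) * (3 * b * (\<alpha> + \<beta>) + 2 * c) = 0"
    using q' by algebra
  then have 1: "3 * b * (\<alpha> + \<beta>) + 2 * c = 0" using assms(1) by simp
  have "(\<alpha> - \<beta>) * (b * (\<alpha>^2 + \<alpha> * \<beta> + \<beta>^2) + c * (\<alpha> + \<beta>) + d) = 0"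
    using q by algebra
  then have 2: "b * (\<alpha>^2 + \<alpha> * \<beta> + \<beta>^2) + c * (\<alpha> + \<beta>) + d = 0" using assms(1) by simp
  \<comment> \<open>The mean of the two derivative values of the remainder minus its difference
    quotient is \<open>b * (\<alpha> - \<beta>)^2 / 2\<close>.\<close>
  have "b * (\<alpha> - \<beta>)^2 = 0"
    using q' 2 by algebra
  then have "b = 0" using assms(1) by simp
  moreover from this 1 have "c = 0" by simp
  moreover from calculation 2 have "d = 0" by simp
  moreover from calculation q have "e = 0" by simp
  ultimately show "B = - 2 * A * (\<alpha> + \<beta>)"
    and "A * t^4 + B * t^3 + C * t^2 + D * t + G = A * ((t - \<alpha>) * (t - \<beta>))^2"
    using eq[of t] by (simp_all add: b_def)
qed

section \<open>Coordinates adapted to the two axes\<close>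

text \<open>Both parabolas open in the positive coordinate directions; this forces the order of the
  y-coordinates of the vertices (\<open>y_less\<close>).\<close>

locale parabolic_quadrilateral =
  fixes F1 :: point and d1 :: "point set" and F2 :: point and d2 :: "point set"
    and org w1 w2 e1 e2 :: point and k l m n x1 x2 x3 x4 y1 y2 y3 y4 :: real
  assumes k: "k > 0" and l: "l > 0"
    and e_norm: "e1 \<bullet> e1 = e2 \<bullet> e2"
    and dual: "w1 \<bullet> e1 = 1" "w1 \<bullet> e2 = 0" "w2 \<bullet> e1 = 0" "w2 \<bullet> e2 = 1"
    and rep: "\<And>X. X = (w1 \<bullet> X) *\<^sub>R e1 + (w2 \<bullet> X) *\<^sub>R e2"
    and par1: "\<And>x y. org + x *\<^sub>R e1 + y *\<^sub>R e2 \<in> parabola F1 d1 \<longleftrightarrow> y = k * x\<^sup>2 + m"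
    and reg1: "\<And>x y. org + x *\<^sub>R e1 + y *\<^sub>R e2 \<in> parabolic_region F1 d1 \<longleftrightarrow> k * x\<^sup>2 + m \<le> y"
    and par2: "\<And>x y. org + x *\<^sub>R e1 + y *\<^sub>R e2 \<in> parabola F2 d2 \<longleftrightarrow> x = l * y\<^sup>2 + n"
    and reg2: "\<And>x y. org + x *\<^sub>R e1 + y *\<^sub>R e2 \<in> parabolic_region F2 d2 \<longleftrightarrow> l * y\<^sup>2 + n \<le> x"
    and x_less: "x1 < x2" "x2 < x3" "x3 < x4"
    and on1: "y1 = k * x1\<^sup>2 + m" "y2 = k * x2\<^sup>2 + m" "y3 = k * x3\<^sup>2 + m" "y4 = k * x4\<^sup>2 + m"
    and on2: "x1 = l * y1\<^sup>2 + n" "x2 = l * y2\<^sup>2 + n" "x3 = l * y3\<^sup>2 + n" "x4 = l * y4\<^sup>2 + n"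
begin

definition crv :: "real \<Rightarrow> point" where
  "crv t = org + t *\<^sub>R e1 + (k * t\<^sup>2 + m) *\<^sub>R e2"

lemma coord_crv [simp]: "w1 \<bullet> (crv t - org) = t" "w2 \<bullet> (crv t - org) = k * t\<^sup>2 + m"
  by (simp_all add: crv_def inner_add_right dual)

lemma crv_eq_iff [simp]: "crv s = crv t \<longleftrightarrow> s = t"
  by (metis coord_crv(1))

lemma inner_rep: "Z \<bullet> X = (w1 \<bullet> X) * (Z \<bullet> e1) + (w2 \<bullet> X) * (Z \<bullet> e2)"
proof -
  have "Z \<bullet> X = Z \<bullet> ((w1 \<bullet> X) *\<^sub>R e1 + (w2 \<bullet> X) *\<^sub>R e2)"
    using rep[of X] by (rule arg_cong)
  then show ?thesis by (simp add: inner_add_right)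
qed

lemma point_rep: "X = org + (w1 \<bullet> (X - org)) *\<^sub>R e1 + (w2 \<bullet> (X - org)) *\<^sub>R e2"
proof -
  have "X = org + (X - org)" by simp
  also have "\<dots> = org + ((w1 \<bullet> (X - org)) *\<^sub>R e1 + (w2 \<bullet> (X - org)) *\<^sub>R e2)"
    by (rule arg_cong[OF rep])
  finally show ?thesis by (simp only: add.assoc)
qed

lemma in_parabola1_iff: "X \<in> parabola F1 d1 \<longleftrightarrow> X = crv (w1 \<bullet> (X - org))"
proof
  assume "X \<in> parabola F1 d1"
  then have "org + (w1 \<bullet> (X - org)) *\<^sub>R e1 + (w2 \<bullet> (X - org)) *\<^sub>R e2 \<in> parabola F1 d1"
    by (simp only: point_rep[symmetric])
  then have *: "w2 \<bullet> (X - org) = k * (w1 \<bullet> (X - org))\<^sup>2 + m" by (simp only: par1)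
  have "X = org + (w1 \<bullet> (X - org)) *\<^sub>R e1 + (w2 \<bullet> (X - org)) *\<^sub>R e2" by (rule point_rep)
  also have "\<dots> = crv (w1 \<bullet> (X - org))" by (simp only: * crv_def)
  finally show "X = crv (w1 \<bullet> (X - org))" .
next
  assume "X = crv (w1 \<bullet> (X - org))"
  then show "X \<in> parabola F1 d1" by (metis crv_def par1)
qed

lemma crv_in_parabola1 [simp]: "crv t \<in> parabola F1 d1"
  by (simp add: crv_def par1)

lemma continuous_on_crv: "continuous_on S crv"
  unfolding crv_def by (intro continuous_intros)

text \<open>Substituting the first parabola into the equation of the second gives a quartic in
  \<open>t\<close> whose roots are the x-coordinates of the vertices. It has no cubic term, so the
  roots sum to 0.\<close>

lemma quartic:
  shows "l * (k * t\<^sup>2 + m)\<^sup>2 + n - t = l * k\<^sup>2 * ((t - x1) * (t - x2) * (t - x3) * (t - x4))"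
    and "x1 + x2 + x3 + x4 = 0"
proof -
  define p where "p = [:l * m\<^sup>2 + n, - 1, 2 * l * k * m, 0, l * k\<^sup>2:]"
  have p: "poly p t = l * (k * t\<^sup>2 + m)\<^sup>2 + n - t" for t
    by (simp add: p_def power2_eq_square algebra_simps)
  have p4: "coeff p 4 = l * k\<^sup>2" by (simp add: p_def numeral_eq_Suc)
  have eq: "p = smult (coeff p 4) ([:-x1, 1:] * [:-x2, 1:] * [:-x3, 1:] * [:-x4, 1:])"
    using on1 on2 x_less k l by (intro quartic_with_four_roots) (simp_all only: p, simp_all add: p_def)
  show "l * (k * t\<^sup>2 + m)\<^sup>2 + n - t = l * k\<^sup>2 * ((t - x1) * (t - x2) * (t - x3) * (t - x4))"
    unfolding p[symmetric] by (subst eq) (simp add: p4 algebra_simps)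
  have "coeff p 3 = - (l * k\<^sup>2) * (x1 + x2 + x3 + x4)"
    by (subst eq, unfold p4) (simp add: numeral_eq_Suc algebra_simps)
  moreover have "coeff p 3 = 0" by (simp add: p_def numeral_eq_Suc)
  ultimately show "x1 + x2 + x3 + x4 = 0" using k l by simp
qed

text \<open>The slope of the chord is \<open>k * (x + x')\<close> by the first parabola, and its
  reciprocal is \<open>l * (y + y')\<close> by the second.\<close>

lemma chord:
  assumes "x = l * y\<^sup>2 + n" "x' = l * y'\<^sup>2 + n" "y = k * x\<^sup>2 + m" "y' = k * x'\<^sup>2 + m" "x \<noteq> x'"
  shows "k * l * (x + x') * (y + y') = 1"
proof -
  have "x - x' = l * ((y - y') * (y + y'))" "y - y' = k * ((x - x') * (x + x'))"
    using assms(1-4) by algebra+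
  then have "(x - x') * (k * l * (x + x') * (y + y') - 1) = 0" by algebra
  then show ?thesis using assms(5) by simp
qed

text \<open>On the first parabola \<open>y - y'\<close> has the sign of
  \<open>(x - x') * (x + x')\<close>, so the order of the y-coordinates follows from the signs of
  sums of x-coordinates. Since all four sum to 0, the sign of \<open>x1 + x4\<close>
  decides.\<close>

lemma y_less: "y3 < y2" "y2 < y1" "y1 < y4"
proof -
  note sum = quartic(2)
  have diff: "y' < y" if "y = k * x\<^sup>2 + m" "y' = k * x'\<^sup>2 + m" "(x - x') * (x + x') > 0" for x x' y y'
  proof -
    have "y - y' = k * ((x - x') * (x + x'))"
      unfolding that(1,2) by (simp add: power2_eq_square algebra_simps)
    then show ?thesis using mult_pos_pos[OF k that(3)] by linarith
  qed
  have sgn: "(x + x') * (y + y') > 0" if "k * l * (x + x') * (y + y') = 1" for x x' y y'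
  proof -
    have "(k * l) * ((x + x') * (y + y')) > 0" using that by (simp add: mult.assoc)
    then show ?thesis using zero_less_mult_pos[OF _ mult_pos_pos[OF k l]] by blast
  qed
  have 14: "(x1 + x4) * (y1 + y4) > 0" and 23: "(x2 + x3) * (y2 + y3) > 0"
    using x_less sgn[OF chord[OF on2(1) on2(4) on1(1) on1(4)]]
      sgn[OF chord[OF on2(2) on2(3) on1(2) on1(3)]] by simp_all
  \<comment> \<open>Otherwise \<open>14\<close> and \<open>23\<close> would make
    \<open>y1 + y4\<close> negative and \<open>y2 + y3\<close> positive, although the y-coordinates
    would be ordered as \<open>y2 < y3 < y4 < y1\<close>.\<close>
  have "x1 + x4 > 0"
  proof (rule ccontr)
    assume "\<not> x1 + x4 > 0"
    then have neg: "x1 + x4 < 0" using 14 by (cases "x1 + x4 = 0") auto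
    then have "y1 + y4 < 0" using 14 by (simp add: zero_less_mult_iff)
    moreover have "x2 + x3 > 0" using neg sum by linarith
    then have "y2 + y3 > 0" using 23 by (simp add: zero_less_mult_iff)
    moreover have "y4 < y1" using neg x_less by (intro diff[OF on1(1) on1(4)] mult_neg_neg) auto
    moreover have "y3 < y4" using \<open>x2 + x3 > 0\<close> x_less by (intro diff[OF on1(4) on1(3)] mult_pos_pos) auto
    moreover have "y2 < y3" using \<open>x2 + x3 > 0\<close> x_less by (intro diff[OF on1(3) on1(2)] mult_pos_pos) auto
    ultimately show False by linarith
  qed
  then have neg: "x2 + x3 < 0" "x1 + x2 < 0" using sum x_less by linarith+
  show "y3 < y2" using neg x_less by (intro diff[OF on1(2) on1(3)] mult_neg_neg) auto
  show "y2 < y1" using neg x_less by (intro diff[OF on1(1) on1(2)] mult_neg_neg) auto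
  show "y1 < y4" using \<open>x1 + x4 > 0\<close> x_less by (intro diff[OF on1(4) on1(1)] mult_pos_pos) auto
qed

text \<open>The sign of the quartic decides. Its two quadratic factors are nonpositive on disjoint
  intervals, so never both at once.\<close>

lemma crv_in_region2_iff: "crv t \<in> parabolic_region F2 d2 \<longleftrightarrow> t \<in> {x1..x2} \<union> {x3..x4}"
proof -
  have "crv t \<in> parabolic_region F2 d2 \<longleftrightarrow> l * (k * t\<^sup>2 + m)\<^sup>2 + n - t \<le> 0"
    by (simp add: crv_def reg2)
  also have "\<dots> \<longleftrightarrow> (t - x1) * (t - x2) * (t - x3) * (t - x4) \<le> 0"
    unfolding quartic using k l by (simp add: mult_le_0_iff)
  also have "\<dots> \<longleftrightarrow> t \<in> {x1..x2} \<union> {x3..x4}"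
  proof -
    have between: "(t - a) * (t - b) \<le> 0 \<longleftrightarrow> a \<le> t \<and> t \<le> b" if "a < b" for a b
      using that by (auto simp: mult_le_0_iff)
    have "(t - x1) * (t - x2) * ((t - x3) * (t - x4)) \<le> 0 \<longleftrightarrow>
        (t - x1) * (t - x2) \<le> 0 \<or> (t - x3) * (t - x4) \<le> 0"
      using between[of x1 x2] between[of x3 x4] x_less by (smt (verit) mult_le_0_iff)
    then show ?thesis
      using between[of x1 x2] between[of x3 x4] x_less by (simp add: mult.assoc)
  qed
  finally show ?thesis .
qed

section \<open>Vertices and the sides carried by the first parabola\<close>

lemma vertices: "pq_vertices F1 d1 F2 d2 = crv ` {x1, x2, x3, x4}"
proof -
  have "crv t \<in> parabola F2 d2 \<longleftrightarrow> l * (k * t\<^sup>2 + m)\<^sup>2 + n - t = 0" for t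
    by (auto simp: crv_def par2)
  then have iff: "crv t \<in> parabola F2 d2 \<longleftrightarrow> t \<in> {x1, x2, x3, x4}" for t
    unfolding quartic using k l by auto
  show ?thesis
  proof (intro set_eqI iffI)
    fix X assume "X \<in> pq_vertices F1 d1 F2 d2"
    then have X: "X = crv (w1 \<bullet> (X - org))" and "X \<in> parabola F2 d2"
      unfolding pq_vertices_def in_parabola1_iff[symmetric] by auto
    then have "w1 \<bullet> (X - org) \<in> {x1, x2, x3, x4}" using iff by metis
    with X show "X \<in> crv ` {x1, x2, x3, x4}" by (rule image_eqI)
  next
    fix X assume "X \<in> crv ` {x1, x2, x3, x4}"
    then show "X \<in> pq_vertices F1 d1 F2 d2" unfolding pq_vertices_def using iff by auto
  qed
qed

text \<open>The point belongs to the region, but arbitrarily small moves in the direction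
  \<open>- e2\<close> lead out of the first parabola.\<close>

lemma crv_in_frontier:
  assumes "t \<in> {x1..x2} \<union> {x3..x4}"
  shows "crv t \<in> frontier (pq_region F1 d1 F2 d2)"
proof -
  have "crv t \<in> pq_region F1 d1 F2 d2"
    using assms crv_in_region2_iff[of t] reg1[of t "k * t\<^sup>2 + m"] by (simp add: pq_region_def crv_def)
  moreover have "crv t \<notin> interior (pq_region F1 d1 F2 d2)"
  proof
    assume "crv t \<in> interior (pq_region F1 d1 F2 d2)"
    then obtain \<epsilon> where \<epsilon>: "\<epsilon> > 0" "ball (crv t) \<epsilon> \<subseteq> pq_region F1 d1 F2 d2"
      by (auto simp: mem_interior)
    define \<delta> where "\<delta> = \<epsilon> / (norm e2 + 1)"
    have \<delta>: "\<delta> > 0" "\<delta> * norm e2 < \<epsilon>"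
      using \<epsilon>(1) by (auto simp: \<delta>_def field_simps add_pos_nonneg)
    have "crv t - \<delta> *\<^sub>R e2 \<in> ball (crv t) \<epsilon>" using \<delta> by (simp add: dist_norm)
    moreover have "crv t - \<delta> *\<^sub>R e2 = org + t *\<^sub>R e1 + (k * t\<^sup>2 + m - \<delta>) *\<^sub>R e2"
      by (simp add: crv_def algebra_simps)
    ultimately show False using \<epsilon>(2) reg1[of t "k * t\<^sup>2 + m - \<delta>"] \<delta>(1) by (auto simp: pq_region_def)
  qed
  ultimately show ?thesis using closure_subset by (auto simp: frontier_def)
qed

lemma crv_side_path:
  assumes "(u, v) = (x1, x2) \<or> (u, v) = (x3, x4)"
  shows "\<exists>g. pq_side_path F1 d1 F2 d2 g \<and> path_image g = crv ` {u..v} \<and>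
    pathstart g = crv u \<and> pathfinish g = crv v"
proof (intro exI conjI)
  let ?g = "crv \<circ> linepath u v"
  have uv: "u < v" using assms x_less by auto
  show im: "path_image ?g = crv ` {u..v}"
    using uv by (simp add: path_image_compose closed_segment_eq_real_ivl)
  show st: "pathstart ?g = crv u" "pathfinish ?g = crv v"
    by (simp_all add: pathstart_compose pathfinish_compose)
  have "arc ?g"
    using arc_linepath[of u v] uv
    by (auto simp: arc_def inj_on_def intro!: path_continuous_image continuous_on_crv)
  then show "pq_side_path F1 d1 F2 d2 ?g"
    unfolding pq_side_path_def im st vertices
    using assms x_less crv_in_frontier by (auto simp: inj_image_mem_iff)
qed

text \<open>In the x-coordinate the path image is a connected subset \<open>T\<close> of two
  disjoint intervals, so it lies in one of them. Its endpoints are distinct vertices, hence the two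
  ends of that interval, and connectedness fills in the rest.\<close>

lemma side_path_on_parabola1:
  assumes g: "pq_side_path F1 d1 F2 d2 g" and "path_image g \<subseteq> parabola F1 d1"
  obtains u v where "(u, v) = (x1, x2) \<or> (u, v) = (x3, x4)" "path_image g = crv ` {u..v}"
    "{pathstart g, pathfinish g} = {crv u, crv v}"
proof -
  define T where "T = (\<lambda>X. w1 \<bullet> (X - org)) ` path_image g"
  have arc: "arc g" and fr: "path_image g \<subseteq> frontier (pq_region F1 d1 F2 d2)"
    and vt: "path_image g \<inter> pq_vertices F1 d1 F2 d2 = {pathstart g, pathfinish g}"
    using g by (auto simp: pq_side_path_def)
  have *: "crv (w1 \<bullet> (X - org)) = X" if "X \<in> path_image g" for X
    using that assms(2) in_parabola1_iff by (metis subsetD)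
  have T: "path_image g = crv ` T"
    unfolding T_def image_image by (simp add: * cong: image_cong_simp)
  have "closed (pq_region F1 d1 F2 d2)"
    unfolding pq_region_def by (intro closed_Int closed_parabolic_region)
  then have "path_image g \<subseteq> parabolic_region F2 d2"
    using fr frontier_subset_closed unfolding pq_region_def by blast
  then have sub: "T \<subseteq> {x1..x2} \<union> {x3..x4}"
    using crv_in_region2_iff T by blast
  have "connected T"
    unfolding T_def using arc
    by (intro connected_continuous_image continuous_intros connected_path_image arc_imp_path)
  then have ivl: "t \<in> T" if "a \<in> T" "b \<in> T" "a \<le> t" "t \<le> b" for a b t
    using that connectedD_interval by blast
  obtain a b where ab: "pathstart g = crv a" "pathfinish g = crv b" "a \<in> T" "b \<in> T"
    using T pathstart_in_path_image[of g] pathfinish_in_path_image[of g] by (metis imageE)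
  have "a \<noteq> b" using arc_distinct_ends[OF arc] ab by auto
  have "crv a \<in> pq_vertices F1 d1 F2 d2" "crv b \<in> pq_vertices F1 d1 F2 d2"
    using vt ab by auto
  then have "a \<in> {x1, x2, x3, x4}" "b \<in> {x1, x2, x3, x4}" by (auto simp: vertices)
  \<comment> \<open>A parameter between the two arcs; an interval that avoids it stays on one
    side.\<close>
  have gap: "(x2 + x3) / 2 \<notin> T" using sub x_less by (auto simp: field_simps)
  have "\<exists>u v. ((u, v) = (x1, x2) \<or> (u, v) = (x3, x4)) \<and> T \<subseteq> {u..v}"
  proof (cases "\<exists>t\<in>T. t \<le> x2")
    case True
    then obtain t0 where t0: "t0 \<in> T" "t0 \<le> x2" by blast
    have "t \<le> x2" if "t \<in> T" for t
    proof (rule ccontr)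
      assume "\<not> t \<le> x2"
      then have "x3 \<le> t" using sub that by fastforce
      then have "t0 \<le> (x2 + x3) / 2" "(x2 + x3) / 2 \<le> t" using x_less t0(2) by simp_all
      then have "(x2 + x3) / 2 \<in> T" by (rule ivl[OF t0(1) that])
      then show False using gap by blast
    qed
    then have "T \<subseteq> {x1..x2}" using sub x_less by fastforce
    then show ?thesis by blast
  next
    case False
    then have "T \<subseteq> {x3..x4}" using sub by force
    then show ?thesis by blast
  qed
  then obtain u v where uv: "(u, v) = (x1, x2) \<or> (u, v) = (x3, x4)" "T \<subseteq> {u..v}" by blast
  then have "a \<in> {u, v}" "b \<in> {u, v}"
    using ab(3,4) \<open>a \<in> {x1, x2, x3, x4}\<close> \<open>b \<in> {x1, x2, x3, x4}\<close> x_less by auto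
  with \<open>a \<noteq> b\<close> have s: "{a, b} = {u, v}" by auto
  then have "u \<in> T" "v \<in> T" using ab(3,4) by (metis doubleton_eq_iff)+
  then have "{u..v} \<subseteq> T" by (meson atLeastAtMost_iff ivl subsetI)
  then have "T = {u..v}" using uv(2) by blast
  then have "path_image g = crv ` {u..v}" using T by simp
  moreover have "crv ` {a, b} = crv ` {u, v}" by (simp only: s)
  then have "{pathstart g, pathfinish g} = {crv u, crv v}" using ab by simp
  ultimately show thesis by (rule that[OF uv(1)])
qed

end

section \<open>Sides and diagonals\<close>

text \<open>A segment determines its endpoints only up to order, and exchanging them merely changes
  the sign of the direction vector.\<close>

lemma orthogonal_diff_swap:
  assumes "{A, C} = {A', C'}" "{B, D} = {B', D'}"
  shows "orthogonal (C - A) (D - B) \<longleftrightarrow> orthogonal (C' - A') (D' - B')"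
proof -
  have "C - A = C' - A' \<or> C - A = - (C' - A')" "D - B = D' - B' \<or> D - B = - (D' - B')"
    using assms unfolding doubleton_eq_iff by auto
  then show ?thesis
    by (elim disjE) (simp_all only: orthogonal_def inner_minus_left inner_minus_right
      minus_minus neg_equal_0_iff_equal)
qed

context parabolic_quadrilateral
begin

text \<open>The hypotheses are symmetric in the two coordinates; by \<open>y_less\<close> the
  vertices in the order of increasing y are the third, second, first and fourth.\<close>

lemma swapped:
  "parabolic_quadrilateral F2 d2 F1 d1 org w2 w1 e2 e1 l k n m y3 y2 y1 y4 x3 x2 x1 x4"
proof -
  have rep': "X = (w2 \<bullet> X) *\<^sub>R e2 + (w1 \<bullet> X) *\<^sub>R e1" for X
    by (subst add.commute) (rule rep)
  have swap: "org + x *\<^sub>R e2 + y *\<^sub>R e1 = org + y *\<^sub>R e1 + x *\<^sub>R e2" for x y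
    by (simp add: algebra_simps)
  show ?thesis
    by (unfold_locales, unfold swap)
      (rule rep' k l e_norm[symmetric] dual x_less y_less on1 on2 par1 par2 reg1 reg2)+
qed

text \<open>Exchanging the coordinates also exchanges the first and the third vertex.\<close>

sublocale sw: parabolic_quadrilateral F2 d2 F1 d1 org w2 w1 e2 e1 l k n m y3 y2 y1 y4 x3 x2 x1 x4
  by (rule swapped)

lemma sw_crv [simp]: "sw.crv y1 = crv x1" "sw.crv y2 = crv x2" "sw.crv y3 = crv x3" "sw.crv y4 = crv x4"
  by (simp_all only: crv_def sw.crv_def on1[symmetric] on2[symmetric], simp_all add: algebra_simps)

lemma distinct_vertices [simp]:
  "x1 \<noteq> x2" "x1 \<noteq> x3" "x1 \<noteq> x4" "x2 \<noteq> x3" "x2 \<noteq> x4" "x3 \<noteq> x4"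
  "x2 \<noteq> x1" "x3 \<noteq> x1" "x4 \<noteq> x1" "x3 \<noteq> x2" "x4 \<noteq> x2" "x4 \<noteq> x3"
  using x_less by auto

lemma side_path_cases:
  assumes "pq_side_path F1 d1 F2 d2 g"
  shows "(path_image g, {pathstart g, pathfinish g}) \<in>
    {(crv ` {x1..x2}, {crv x1, crv x2}), (crv ` {x3..x4}, {crv x3, crv x4}),
     (sw.crv ` {y3..y2}, {crv x3, crv x2}), (sw.crv ` {y1..y4}, {crv x1, crv x4})}"
proof (cases "path_image g \<subseteq> parabola F1 d1")
  case True
  obtain u v where uv: "(u, v) = (x1, x2) \<or> (u, v) = (x3, x4)"
    and g: "path_image g = crv ` {u..v}" "{pathstart g, pathfinish g} = {crv u, crv v}"
    by (rule side_path_on_parabola1[OF assms True])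
  show ?thesis unfolding g using uv by (elim disjE) simp_all
next
  case False
  then have sub: "path_image g \<subseteq> parabola F2 d2" using assms by (simp add: pq_side_path_def)
  have "pq_side_path F2 d2 F1 d1 g" using assms by (simp only: pq_side_path_commute)
  then obtain u v where uv: "(u, v) = (y3, y2) \<or> (u, v) = (y1, y4)"
    and g: "path_image g = sw.crv ` {u..v}" "{pathstart g, pathfinish g} = {sw.crv u, sw.crv v}"
    by (rule sw.side_path_on_parabola1[OF _ sub])
  show ?thesis unfolding g using uv by (elim disjE) simp_all
qed

lemma sides:
  "pq_sides F1 d1 F2 d2 = {crv ` {x1..x2}, crv ` {x3..x4}, sw.crv ` {y3..y2}, sw.crv ` {y1..y4}}"
proof
  show "pq_sides F1 d1 F2 d2 \<subseteq> {crv ` {x1..x2}, crv ` {x3..x4}, sw.crv ` {y3..y2}, sw.crv ` {y1..y4}}"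
  proof
    fix S assume "S \<in> pq_sides F1 d1 F2 d2"
    then obtain g where "S = path_image g" "pq_side_path F1 d1 F2 d2 g"
      unfolding pq_sides_def by blast
    then show "S \<in> {crv ` {x1..x2}, crv ` {x3..x4}, sw.crv ` {y3..y2}, sw.crv ` {y1..y4}}"
      using side_path_cases[of g] by simp blast
  qed
  have "crv ` {u..v} \<in> pq_sides F1 d1 F2 d2" if "(u, v) = (x1, x2) \<or> (u, v) = (x3, x4)" for u v
    using crv_side_path[OF that] unfolding pq_sides_def by (metis (mono_tags, lifting) mem_Collect_eq)
  moreover have "sw.crv ` {u..v} \<in> pq_sides F1 d1 F2 d2" if "(u, v) = (y3, y2) \<or> (u, v) = (y1, y4)" for u v
    using sw.crv_side_path[OF that] unfolding pq_sides_def pq_side_path_commute[of F2 d2 F1 d1]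
    by (metis (mono_tags, lifting) mem_Collect_eq)
  ultimately show "{crv ` {x1..x2}, crv ` {x3..x4}, sw.crv ` {y3..y2}, sw.crv ` {y1..y4}}
      \<subseteq> pq_sides F1 d1 F2 d2" by simp
qed

lemma consecutive_iff:
  "pq_consecutive F1 d1 F2 d2 A B \<longleftrightarrow>
    {A, B} \<in> {{crv x1, crv x2}, {crv x3, crv x4}, {crv x3, crv x2}, {crv x1, crv x4}}"
proof
  assume "pq_consecutive F1 d1 F2 d2 A B"
  then obtain g where "pq_side_path F1 d1 F2 d2 g" "pathstart g = A" "pathfinish g = B"
    unfolding pq_consecutive_def by blast
  with side_path_cases[of g] show "{A, B} \<in> {{crv x1, crv x2}, {crv x3, crv x4}, {crv x3, crv x2}, {crv x1, crv x4}}"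
    by simp blast
next
  have sym: "pq_consecutive F1 d1 F2 d2 X Y \<Longrightarrow> pq_consecutive F1 d1 F2 d2 Y X" for X Y
    unfolding pq_consecutive_def
    by (metis pathfinish_reversepath pathstart_reversepath pq_side_path_reversepath)
  have "pq_consecutive F1 d1 F2 d2 (crv x1) (crv x2)" "pq_consecutive F1 d1 F2 d2 (crv x3) (crv x4)"
    unfolding pq_consecutive_def using crv_side_path[of x1 x2] crv_side_path[of x3 x4] by metis+
  moreover have "pq_consecutive F1 d1 F2 d2 (crv x3) (crv x2)" "pq_consecutive F1 d1 F2 d2 (crv x1) (crv x4)"
    using sw.crv_side_path[of y3 y2] sw.crv_side_path[of y1 y4]
    unfolding pq_consecutive_def pq_side_path_commute[of F2 d2 F1 d1] sw_crv by metis+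
  moreover assume "{A, B} \<in> {{crv x1, crv x2}, {crv x3, crv x4}, {crv x3, crv x2}, {crv x1, crv x4}}"
  ultimately show "pq_consecutive F1 d1 F2 d2 A B"
    unfolding insert_iff empty_iff doubleton_eq_iff using sym by blast
qed

text \<open>Sides join four of the six pairs of vertices, which leaves these two.\<close>

lemma opposite_iff:
  "pq_opposite F1 d1 F2 d2 A C \<longleftrightarrow> {A, C} = {crv x1, crv x3} \<or> {A, C} = {crv x2, crv x4}"
proof -
  have "pq_opposite F1 d1 F2 d2 A C \<longleftrightarrow>
      A \<in> crv ` {x1, x2, x3, x4} \<and> C \<in> crv ` {x1, x2, x3, x4} \<and> A \<noteq> C \<and>
      {A, C} \<notin> {{crv x1, crv x2}, {crv x3, crv x4}, {crv x3, crv x2}, {crv x1, crv x4}}"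
    by (simp only: pq_opposite_def vertices consecutive_iff)
  also have "\<dots> \<longleftrightarrow> {A, C} = {crv x1, crv x3} \<or> {A, C} = {crv x2, crv x4}"
    by (auto simp: doubleton_eq_iff)
  finally show ?thesis .
qed

lemma diagonals:
  "pq_diagonals F1 d1 F2 d2 = {closed_segment (crv x1) (crv x3), closed_segment (crv x2) (crv x4)}"
proof
  show "pq_diagonals F1 d1 F2 d2 \<subseteq> {closed_segment (crv x1) (crv x3), closed_segment (crv x2) (crv x4)}"
    unfolding pq_diagonals_def opposite_iff
    by (auto simp: doubleton_eq_iff closed_segment_commute)
  show "{closed_segment (crv x1) (crv x3), closed_segment (crv x2) (crv x4)} \<subseteq> pq_diagonals F1 d1 F2 d2"
    unfolding pq_diagonals_def opposite_iff by blast
qed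

lemma perpendicular_diagonals_iff:
  "(\<exists>A B C D. pq_diagonals F1 d1 F2 d2 = {closed_segment A C, closed_segment B D} \<and>
      closed_segment A C \<noteq> closed_segment B D \<and> orthogonal (C - A) (D - B)) \<longleftrightarrow>
    orthogonal (crv x3 - crv x1) (crv x4 - crv x2)"
proof
  assume "\<exists>A B C D. pq_diagonals F1 d1 F2 d2 = {closed_segment A C, closed_segment B D} \<and>
      closed_segment A C \<noteq> closed_segment B D \<and> orthogonal (C - A) (D - B)"
  then obtain A B C D where
    eq: "{closed_segment (crv x1) (crv x3), closed_segment (crv x2) (crv x4)}
      = {closed_segment A C, closed_segment B D}" and o: "orthogonal (C - A) (D - B)"
    unfolding diagonals by blast
  from eq consider
    "closed_segment A C = closed_segment (crv x1) (crv x3)" "closed_segment B D = closed_segment (crv x2) (crv x4)"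
    | "closed_segment B D = closed_segment (crv x1) (crv x3)" "closed_segment A C = closed_segment (crv x2) (crv x4)"
    by (auto simp: doubleton_eq_iff)
  then show "orthogonal (crv x3 - crv x1) (crv x4 - crv x2)"
  proof cases
    case 1
    then show ?thesis
      using orthogonal_diff_swap[of A C "crv x1" "crv x3" B D "crv x2" "crv x4"] o
      by (simp only: closed_segment_eq)
  next
    case 2
    then have "orthogonal (D - B) (C - A) \<longleftrightarrow> orthogonal (crv x3 - crv x1) (crv x4 - crv x2)"
      by (intro orthogonal_diff_swap) (simp_all only: closed_segment_eq)
    then show ?thesis using o by (simp only: orthogonal_commute)
  qed
next
  assume "orthogonal (crv x3 - crv x1) (crv x4 - crv x2)"
  moreover have "closed_segment (crv x1) (crv x3) \<noteq> closed_segment (crv x2) (crv x4)"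
    unfolding closed_segment_eq doubleton_eq_iff by simp
  ultimately show "\<exists>A B C D. pq_diagonals F1 d1 F2 d2 = {closed_segment A C, closed_segment B D} \<and>
      closed_segment A C \<noteq> closed_segment B D \<and> orthogonal (C - A) (D - B)"
    unfolding diagonals by blast
qed

text \<open>The normal is the gradient of \<open>k * x^2 + m - y\<close>. Applied to
  \<open>crv s - crv t\<close> it gives exactly \<open>- (k * (s - t)^2)\<close>, and by
  Cauchy-Schwarz \<open>\<bar>s - t\<bar>\<close> is at most \<open>norm w1\<close> times the
  distance.\<close>

lemma tangent_line_crv:
  assumes "a < b" "t \<in> {a..b}"
  shows "tangent_line_at (crv ` {a..b}) (crv t) {X. ((2 * k * t) *\<^sub>R w1 - w2) \<bullet> (X - crv t) = 0}"
proof (rule tangent_line_atI)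
  show "(2 * k * t) *\<^sub>R w1 - w2 \<noteq> 0"
  proof
    assume "(2 * k * t) *\<^sub>R w1 - w2 = 0"
    then have "((2 * k * t) *\<^sub>R w1 - w2) \<bullet> e2 = 0" by simp
    then show False by (simp add: inner_diff_left dual)
  qed
  show "crv t \<in> crv ` {a..b}" using assms by blast
  have "connected (crv ` {a..b})"
    by (intro connected_continuous_image continuous_on_crv) simp
  moreover have "crv a \<in> crv ` {a..b}" "crv b \<in> crv ` {a..b}" "crv a \<noteq> crv b" using assms by auto
  ultimately show "crv t islimpt crv ` {a..b}"
    using \<open>crv t \<in> _\<close> by (metis connected_imp_perfect singletonD)
  fix X assume "X \<in> crv ` {a..b}"
  then obtain s where X: "X = crv s" by blast
  have d: "crv s - crv t = (s - t) *\<^sub>R e1 + (k * s\<^sup>2 - k * t\<^sup>2) *\<^sub>R e2"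
    by (simp add: crv_def algebra_simps)
  have "((2 * k * t) *\<^sub>R w1 - w2) \<bullet> (X - crv t) = - (k * (s - t)\<^sup>2)"
    unfolding X d by (simp add: inner_diff_left inner_add_right dual power2_eq_square algebra_simps)
  then have "\<bar>((2 * k * t) *\<^sub>R w1 - w2) \<bullet> (X - crv t)\<bar> = k * \<bar>s - t\<bar>\<^sup>2" using k by simp
  also have "\<bar>s - t\<bar> = \<bar>w1 \<bullet> (X - crv t)\<bar>"
    unfolding X d by (simp add: inner_add_right dual)
  also have "k * \<bar>w1 \<bullet> (X - crv t)\<bar>\<^sup>2 \<le> k * (norm w1 * norm (X - crv t))\<^sup>2"
    using k Cauchy_Schwarz_ineq2 by (intro mult_left_mono power_mono) auto
  finally show "\<bar>((2 * k * t) *\<^sub>R w1 - w2) \<bullet> (X - crv t)\<bar> \<le> k * (norm w1)\<^sup>2 * (norm (X - crv t))\<^sup>2"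
    by (simp add: power_mult_distrib mult.assoc)
qed

text \<open>Tangent lines are unique, so tangency at a common point means that the radius is
  orthogonal to the direction \<open>e1 + (2 * k * t) *\<^sub>R e2\<close> of the arc.\<close>

lemma tangent_circle_crv_iff:
  assumes "r > 0" "a < b"
  shows "tangent_curves (sphere c r) (crv ` {a..b}) \<longleftrightarrow>
    (\<exists>t\<in>{a..b}. dist c (crv t) = r \<and> (crv t - c) \<bullet> (e1 + (2 * k * t) *\<^sub>R e2) = 0)"
proof
  assume "tangent_curves (sphere c r) (crv ` {a..b})"
  then obtain p L where pL: "tangent_line_at (sphere c r) p L" "tangent_line_at (crv ` {a..b}) p L"
    unfolding tangent_curves_def by blast
  then have p: "p \<in> sphere c r" "p \<in> crv ` {a..b}" unfolding tangent_line_at_def by auto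
  then obtain t where t: "t \<in> {a..b}" "p = crv t" by blast
  have "L = {X. (p - c) \<bullet> (X - p) = 0}"
    using tangent_line_unique[OF pL(1) tangent_line_sphere[OF assms(1) p(1)]] .
  moreover have "L = {X. ((2 * k * t) *\<^sub>R w1 - w2) \<bullet> (X - p) = 0}"
    using tangent_line_unique[OF pL(2)[unfolded t(2)] tangent_line_crv[OF assms(2) t(1)]]
    unfolding t(2) .
  moreover have "((2 * k * t) *\<^sub>R w1 - w2) \<bullet> (p + (e1 + (2 * k * t) *\<^sub>R e2) - p) = 0"
    by (simp add: inner_diff_left inner_add_right dual)
  ultimately have "(p - c) \<bullet> (p + (e1 + (2 * k * t) *\<^sub>R e2) - p) = 0" by blast
  then have "(crv t - c) \<bullet> (e1 + (2 * k * t) *\<^sub>R e2) = 0" using t(2) by simp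
  moreover have "dist c (crv t) = r" using p(1) t(2) by simp
  ultimately show "\<exists>t\<in>{a..b}. dist c (crv t) = r \<and> (crv t - c) \<bullet> (e1 + (2 * k * t) *\<^sub>R e2) = 0"
    using t(1) by blast
next
  assume "\<exists>t\<in>{a..b}. dist c (crv t) = r \<and> (crv t - c) \<bullet> (e1 + (2 * k * t) *\<^sub>R e2) = 0"
  then obtain t where t: "t \<in> {a..b}" "dist c (crv t) = r"
    and perp: "(crv t - c) \<bullet> (e1 + (2 * k * t) *\<^sub>R e2) = 0" by blast
  define Z where "Z = crv t - c"
  \<comment> \<open>Orthogonality to the direction of the arc makes the radius \<open>Z\<close> a
    multiple of the normal of the parabola, with the factor
    \<open>- (Z \<bullet> e2)\<close>.\<close>
  have e1: "Z \<bullet> e1 = - (2 * k * t * (Z \<bullet> e2))"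
    using perp by (simp add: Z_def[symmetric] inner_add_right)
  have rep': "Z \<bullet> X = - (Z \<bullet> e2) * (((2 * k * t) *\<^sub>R w1 - w2) \<bullet> X)" for X
    unfolding inner_rep[of Z X] e1 by (simp add: inner_diff_left algebra_simps)
  have "Z \<bullet> e2 \<noteq> 0"
  proof
    assume "Z \<bullet> e2 = 0"
    then have "Z \<bullet> Z = 0" using rep'[of Z] by simp
    then show False using t(2) assms(1) by (simp add: Z_def)
  qed
  then have "((2 * k * t) *\<^sub>R w1 - w2) \<bullet> X = 0 \<longleftrightarrow> Z \<bullet> X = 0" for X
    using rep'[of X] by auto
  then have "{X. ((2 * k * t) *\<^sub>R w1 - w2) \<bullet> (X - crv t) = 0} = {X. (crv t - c) \<bullet> (X - crv t) = 0}"
    by (simp only: Z_def[symmetric])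
  moreover have "crv t \<in> sphere c r" using t(2) by simp
  ultimately show "tangent_curves (sphere c r) (crv ` {a..b})"
    using tangent_line_sphere[OF assms(1), of "crv t" c] tangent_line_crv[OF assms(2) t(1)]
    unfolding tangent_curves_def by auto
qed

end

section \<open>The inscribed circle\<close>

context parabolic_quadrilateral
begin

definition E :: real where "E = e1 \<bullet> e1"

text \<open>The negated cosine of the angle between \<open>e1\<close> and \<open>e2\<close>, so that
  the squared length of a vector with coordinates x, y is
  \<open>E * (x^2 - 2 * g * x * y + y^2)\<close>.\<close>

definition g :: real where "g = - (e1 \<bullet> e2) / (e1 \<bullet> e1)"

text \<open>The centre lies on both axes, since a circle that touches a parabola twice does.\<close>

definition centre :: point where
  "centre = org + (g / (2 * k)) *\<^sub>R e1 + (g / (2 * l)) *\<^sub>R e2"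

text \<open>The constant that remains when \<open>E\<close> times the square of an affine function
  is split off the squared distance from \<open>centre\<close> to points of the first parabola. For
  perpendicular diagonals it is the squared radius.\<close>

definition radius2 :: real where
  "radius2 = E * ((1 - g\<^sup>2) * (g / (2 * k * l) - m / k - 1 / (4 * k\<^sup>2)))"

end

section \<open>Lengths and angles in the oblique coordinates, and circles touching a parabola
  twice\<close>

context parabolic_quadrilateral
begin

lemma sw_E: "sw.E = E" and sw_g: "sw.g = g"
  by (simp_all add: E_def sw.E_def g_def sw.g_def e_norm inner_commute)

lemma E_pos: "E > 0"
  using dual(1) by (auto simp: E_def)

lemma inner_e: "e1 \<bullet> e1 = E" "e2 \<bullet> e2 = E" "e1 \<bullet> e2 = - g * E" "e2 \<bullet> e1 = - g * E"
  using E_pos by (simp_all add: E_def g_def e_norm inner_commute)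

text \<open>\<open>e1 - e2\<close> and \<open>e1 + e2\<close> are nonzero, with squared lengths
  \<open>2 * E * (1 + g)\<close> and \<open>2 * E * (1 - g)\<close>.\<close>

lemma g_bounds: "1 + g > 0" "1 - g > 0"
proof -
  have "w1 \<bullet> (e1 - e2) = 1" "w1 \<bullet> (e1 + e2) = 1"
    by (simp_all add: inner_diff_right inner_add_right dual)
  then have "e1 - e2 \<noteq> 0" "e1 + e2 \<noteq> 0" by (metis inner_zero_right zero_neq_one)+
  then have "(e1 - e2) \<bullet> (e1 - e2) > 0" "(e1 + e2) \<bullet> (e1 + e2) > 0" by simp_all
  moreover have "(e1 - e2) \<bullet> (e1 - e2) = 2 * E * (1 + g)" "(e1 + e2) \<bullet> (e1 + e2) = 2 * E * (1 - g)"
    by (simp_all add: inner_diff_left inner_diff_right inner_add_left inner_add_right inner_e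
        algebra_simps)
  ultimately show "1 + g > 0" "1 - g > 0" using E_pos by (simp_all add: zero_less_mult_iff)
qed

lemma sum_x: "x1 + x2 + x3 + x4 = 0"
  by (rule quartic(2))

lemma sum_y: "y1 + y2 + y3 + y4 = 0"
  using sw.quartic(2) by simp

text \<open>The diagonals have the slopes \<open>k * (x2 + x4)\<close> and
  \<open>k * (x1 + x3)\<close>, which are opposite because the x-coordinates sum to 0.\<close>

lemma y_diff: "y4 - y2 = k * (x2 + x4) * (x4 - x2)" "y3 - y1 = - (k * (x2 + x4)) * (x3 - x1)"
proof -
  show "y4 - y2 = k * (x2 + x4) * (x4 - x2)"
    unfolding on1(2) on1(4) by (simp add: power2_eq_square algebra_simps)
  have "- (x2 + x4) = x1 + x3" using sum_x by simp
  then have "- (k * (x2 + x4)) = k * (x1 + x3)" by (metis mult_minus_right)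
  then show "y3 - y1 = - (k * (x2 + x4)) * (x3 - x1)"
    unfolding on1(1) on1(3) by (simp add: power2_eq_square algebra_simps)
qed

text \<open>The directions are \<open>e1 - s *\<^sub>R e2\<close> and
  \<open>e1 + s *\<^sub>R e2\<close>. As \<open>e1\<close> and \<open>e2\<close> have equal length,
  their inner product is \<open>E * (1 - s^2)\<close>, and \<open>s\<close> is positive.\<close>

lemma orthogonal_diagonals_iff:
  "orthogonal (crv x3 - crv x1) (crv x4 - crv x2) \<longleftrightarrow> k * (x2 + x4) = 1"
proof -
  define s where "s = k * (x2 + x4)"
  have "s > 0" using sum_x x_less k by (simp add: s_def)
  have *: "crv x3 - crv x1 = (x3 - x1) *\<^sub>R e1 + (y3 - y1) *\<^sub>R e2"
    "crv x4 - crv x2 = (x4 - x2) *\<^sub>R e1 + (y4 - y2) *\<^sub>R e2"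
    by (simp_all add: crv_def on1 algebra_simps)
  have "crv x3 - crv x1 = (x3 - x1) *\<^sub>R (e1 - s *\<^sub>R e2)"
    "crv x4 - crv x2 = (x4 - x2) *\<^sub>R (e1 + s *\<^sub>R e2)"
    unfolding * y_diff s_def[symmetric] by (simp_all add: algebra_simps)
  moreover have "(e1 - s *\<^sub>R e2) \<bullet> (e1 + s *\<^sub>R e2) = E * ((1 - s) * (1 + s))"
    by (simp add: inner_diff_left inner_add_right inner_e algebra_simps)
  ultimately have "(crv x3 - crv x1) \<bullet> (crv x4 - crv x2)
      = (x3 - x1) * (x4 - x2) * (E * ((1 - s) * (1 + s)))"
    by (simp only: inner_scaleR_left inner_scaleR_right mult.assoc mult.left_commute)
  then have "orthogonal (crv x3 - crv x1) (crv x4 - crv x2) \<longleftrightarrow>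
      (x3 - x1) * (x4 - x2) * (E * ((1 - s) * (1 + s))) = 0"
    by (simp only: orthogonal_def)
  also have "\<dots> \<longleftrightarrow> s = 1" using E_pos \<open>s > 0\<close> by simp
  finally show ?thesis by (simp only: s_def)
qed

text \<open>The second expression is half the derivative of the first with respect to t.\<close>

lemma dist_crv:
  fixes a b t :: real
  defines "c \<equiv> org + a *\<^sub>R e1 + b *\<^sub>R e2" and "y \<equiv> k * t\<^sup>2 + m"
  shows "(dist c (crv t))\<^sup>2 = E * ((t - a)\<^sup>2 - 2 * g * (t - a) * (y - b) + (y - b)\<^sup>2)"
    and "(crv t - c) \<bullet> (e1 + (2 * k * t) *\<^sub>R e2)
      = E * (t - a - g * (y - b) + 2 * k * t * (y - b - g * (t - a)))"
proof -
  have d: "crv t - c = (t - a) *\<^sub>R e1 + (y - b) *\<^sub>R e2"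
    by (simp add: crv_def c_def y_def algebra_simps)
  have "(dist c (crv t))\<^sup>2 = (crv t - c) \<bullet> (crv t - c)"
    by (simp only: dist_norm norm_minus_commute[of c] power2_norm_eq_inner)
  also have "\<dots> = E * ((t - a)\<^sup>2 - 2 * g * (t - a) * (y - b) + (y - b)\<^sup>2)"
    unfolding d by (simp only: inner_add_left inner_add_right inner_scaleR_left inner_scaleR_right
        inner_e) (simp add: power2_eq_square algebra_simps)
  finally show "(dist c (crv t))\<^sup>2 = E * ((t - a)\<^sup>2 - 2 * g * (t - a) * (y - b) + (y - b)\<^sup>2)" .
  show "(crv t - c) \<bullet> (e1 + (2 * k * t) *\<^sub>R e2)
      = E * (t - a - g * (y - b) + 2 * k * t * (y - b - g * (t - a)))"
    unfolding d by (simp only: inner_add_left inner_add_right inner_scaleR_left inner_scaleR_right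
        inner_e) (simp add: algebra_simps)
qed

text \<open>Along the parabola the squared distance minus \<open>r^2\<close> is a quartic in
  \<open>t\<close>, and each point of contact is a double root. Comparing cubic coefficients gives
  the sum of the two parameters.\<close>

lemma doubly_tangent_circle:
  assumes \<alpha>: "dist c (crv \<alpha>) = r" "(crv \<alpha> - c) \<bullet> (e1 + (2 * k * \<alpha>) *\<^sub>R e2) = 0"
    and \<beta>: "dist c (crv \<beta>) = r" "(crv \<beta> - c) \<bullet> (e1 + (2 * k * \<beta>) *\<^sub>R e2) = 0"
    and "\<alpha> \<noteq> \<beta>"
  shows "k * (\<alpha> + \<beta>) = g" and "(dist c (crv t))\<^sup>2 - r\<^sup>2 = E * (k * (t - \<alpha>) * (t - \<beta>))\<^sup>2"
proof -
  define a b where "a = w1 \<bullet> (c - org)" and "b = w2 \<bullet> (c - org)"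
  have c: "c = org + a *\<^sub>R e1 + b *\<^sub>R e2" unfolding a_def b_def by (rule point_rep)
  define B C D G where "B = - 2 * E * g * k" and "C = E * (2 * k * (m - b) + 2 * g * a * k + 1)"
    and "D = E * (- 2 * g * (m - b) - 2 * a)" and "G = E * (2 * g * a * (m - b) + (m - b)\<^sup>2 + a\<^sup>2) - r\<^sup>2"
  have f: "(dist c (crv t))\<^sup>2 - r\<^sup>2 = E * k\<^sup>2 * t^4 + B * t^3 + C * t^2 + D * t + G" for t
    unfolding c dist_crv B_def C_def D_def G_def
    by (simp add: power4_eq_xxxx power3_eq_cube power2_eq_square algebra_simps)
  have f': "2 * ((crv t - c) \<bullet> (e1 + (2 * k * t) *\<^sub>R e2))
      = 4 * (E * k\<^sup>2) * t^3 + 3 * B * t^2 + 2 * C * t + D" for t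
    unfolding c dist_crv B_def C_def D_def
    by (simp add: power3_eq_cube power2_eq_square algebra_simps)
  have "E * k\<^sup>2 * \<alpha>^4 + B * \<alpha>^3 + C * \<alpha>^2 + D * \<alpha> + G = 0"
    "E * k\<^sup>2 * \<beta>^4 + B * \<beta>^3 + C * \<beta>^2 + D * \<beta> + G = 0"
    "4 * (E * k\<^sup>2) * \<alpha>^3 + 3 * B * \<alpha>^2 + 2 * C * \<alpha> + D = 0"
    "4 * (E * k\<^sup>2) * \<beta>^3 + 3 * B * \<beta>^2 + 2 * C * \<beta> + D = 0"
    unfolding f[symmetric] f'[symmetric] \<alpha> \<beta> by simp_all
  note q = quartic_double_roots[OF \<open>\<alpha> \<noteq> \<beta>\<close> this]
  have "E * k * (k * (\<alpha> + \<beta>) - g) = 0"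
    using q(1) by (simp add: B_def power2_eq_square algebra_simps)
  then show "k * (\<alpha> + \<beta>) = g" using E_pos k by simp
  show "(dist c (crv t))\<^sup>2 - r\<^sup>2 = E * (k * (t - \<alpha>) * (t - \<beta>))\<^sup>2"
    unfolding f q(2) by (simp only: power_mult_distrib mult.assoc)
qed

end

section \<open>The two implications\<close>

context parabolic_quadrilateral
begin

text \<open>At a vertex the factorisations for the two parabolas have equal squares. At the second
  and fourth vertex their signs agree as well, which forces the diagonal through these vertices to
  have slope 1.\<close>

lemma tangent_circle_imp_perpendicular:
  assumes "r > 0" and tan: "\<forall>S \<in> pq_sides F1 d1 F2 d2. tangent_curves (sphere c r) S"
  shows "k * (x2 + x4) = 1"
proof -
  obtain \<alpha> where \<alpha>: "\<alpha> \<in> {x1..x2}" "dist c (crv \<alpha>) = r" "(crv \<alpha> - c) \<bullet> (e1 + (2 * k * \<alpha>) *\<^sub>R e2) = 0"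
    using tan tangent_circle_crv_iff[OF assms(1) x_less(1)] unfolding sides by blast
  obtain \<beta> where \<beta>: "\<beta> \<in> {x3..x4}" "dist c (crv \<beta>) = r" "(crv \<beta> - c) \<bullet> (e1 + (2 * k * \<beta>) *\<^sub>R e2) = 0"
    using tan tangent_circle_crv_iff[OF assms(1) x_less(3)] unfolding sides by blast
  obtain \<gamma> where \<gamma>: "\<gamma> \<in> {y3..y2}" "dist c (sw.crv \<gamma>) = r" "(sw.crv \<gamma> - c) \<bullet> (e2 + (2 * l * \<gamma>) *\<^sub>R e1) = 0"
    using tan sw.tangent_circle_crv_iff[OF assms(1) y_less(1)] unfolding sides by blast
  obtain \<delta> where \<delta>: "\<delta> \<in> {y1..y4}" "dist c (sw.crv \<delta>) = r" "(sw.crv \<delta> - c) \<bullet> (e2 + (2 * l * \<delta>) *\<^sub>R e1) = 0"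
    using tan sw.tangent_circle_crv_iff[OF assms(1) y_less(3)] unfolding sides by blast
  have "\<alpha> \<noteq> \<beta>" "\<gamma> \<noteq> \<delta>" using \<alpha> \<beta> \<gamma> \<delta> x_less y_less by auto
  note P = doubly_tangent_circle[OF \<alpha>(2,3) \<beta>(2,3) \<open>\<alpha> \<noteq> \<beta>\<close>]
  note Q = sw.doubly_tangent_circle[OF \<gamma>(2,3) \<delta>(2,3) \<open>\<gamma> \<noteq> \<delta>\<close>, unfolded sw_E sw_g]
  have eq: "(k * (x - \<alpha>) * (x - \<beta>))\<^sup>2 = (l * (y - \<gamma>) * (y - \<delta>))\<^sup>2" if "sw.crv y = crv x" for x y
    using P(2)[of x] Q(2)[of y] that E_pos by simp
  \<comment> \<open>The second vertex lies between the points of contact on both parabolas, the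
    fourth beyond all of them; this fixes the signs.\<close>
  have "k * (x2 - \<alpha>) * (x2 - \<beta>) \<le> 0" "l * (y2 - \<gamma>) * (y2 - \<delta>) \<le> 0"
    using \<alpha> \<beta> \<gamma> \<delta> x_less y_less k l by (auto intro!: mult_nonneg_nonpos)
  moreover have "\<bar>k * (x2 - \<alpha>) * (x2 - \<beta>)\<bar> = \<bar>l * (y2 - \<gamma>) * (y2 - \<delta>)\<bar>"
    using eq[of y2 x2] by (simp only: sw_crv power2_eq_iff abs_eq_iff simp_thms)
  ultimately have 2: "k * (x2 - \<alpha>) * (x2 - \<beta>) = l * (y2 - \<gamma>) * (y2 - \<delta>)" by linarith
  have "k * (x4 - \<alpha>) * (x4 - \<beta>) \<ge> 0" "l * (y4 - \<gamma>) * (y4 - \<delta>) \<ge> 0"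
    using \<alpha> \<beta> \<gamma> \<delta> x_less y_less k l by (auto intro!: mult_nonneg_nonneg)
  moreover have "\<bar>k * (x4 - \<alpha>) * (x4 - \<beta>)\<bar> = \<bar>l * (y4 - \<gamma>) * (y4 - \<delta>)\<bar>"
    using eq[of y4 x4] by (simp only: sw_crv power2_eq_iff abs_eq_iff simp_thms)
  ultimately have 4: "k * (x4 - \<alpha>) * (x4 - \<beta>) = l * (y4 - \<gamma>) * (y4 - \<delta>)" by linarith
  \<comment> \<open>On its parabola each factorisation is the restriction of an affine function,
    since \<open>k * x^2\<close> equals \<open>y - m\<close> there.\<close>
  have L1: "k * (x - \<alpha>) * (x - \<beta>) = y - m - g * x + k * \<alpha> * \<beta>" if "y = k * x\<^sup>2 + m" for x y
    unfolding that P(1)[symmetric] by (simp add: power2_eq_square algebra_simps)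
  have L2: "l * (y - \<gamma>) * (y - \<delta>) = x - n - g * y + l * \<gamma> * \<delta>" if "x = l * y\<^sup>2 + n" for x y
    unfolding that Q(1)[symmetric] by (simp add: power2_eq_square algebra_simps)
  have "(1 + g) * ((y4 - y2) - (x4 - x2)) = 0"
    using 2 4 unfolding L1[OF on1(2)] L1[OF on1(4)] L2[OF on2(2)] L2[OF on2(4)]
    by (simp add: algebra_simps)
  then have "y4 - y2 = x4 - x2" using g_bounds by simp
  then have "(x4 - x2) * (k * (x2 + x4) - 1) = 0" unfolding y_diff by (simp add: algebra_simps)
  then show ?thesis using x_less by simp
qed

lemma sw_centre: "sw.centre = centre"
  by (simp add: centre_def sw.centre_def sw_g algebra_simps)

text \<open>By \<open>chord\<close> the left side is the reciprocal of the slope of the same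
  diagonal.\<close>

lemma perpendicular_swap:
  assumes "k * (x2 + x4) = 1"
  shows "l * (y2 + y4) = 1"
proof -
  have "(k * (x2 + x4)) * (l * (y2 + y4)) = 1"
    using chord[OF on2(2) on2(4) on1(2) on1(4)] by (simp add: ac_simps)
  then show ?thesis unfolding assms by simp
qed

text \<open>A diagonal of slope 1 has equal extent in x and y. This gives
  \<open>m / k + 1 / (4 * k^2)\<close> and \<open>n / l + 1 / (4 * l^2)\<close> the same value, so
  both parabolas yield the same radius.\<close>

lemma sw_radius2:
  assumes "k * (x2 + x4) = 1"
  shows "sw.radius2 = radius2"
proof -
  have dx: "y4 - y2 = x4 - x2" using y_diff(1) assms by simp
  have sx: "x2 + x4 = 1 / k" and sy: "y2 + y4 = 1 / l"
    using assms perpendicular_swap[OF assms] k l by (simp_all add: field_simps)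
  \<comment> \<open>The sum of the equations at the second and fourth vertex, with
    \<open>2 * (x2^2 + x4^2)\<close> written through the sum and the difference.\<close>
  have "2 * (y2 + y4) = k * ((x2 + x4)\<^sup>2 + (x4 - x2)\<^sup>2) + 4 * m"
    unfolding on1(2) on1(4) by (simp add: power2_eq_square algebra_simps)
  then have 1: "m / k + 1 / (4 * k\<^sup>2) = 1 / (2 * k * l) - (x4 - x2)\<^sup>2 / 4"
    unfolding sx sy using k l by (simp add: field_simps power2_eq_square)
  have "2 * (x2 + x4) = l * ((y2 + y4)\<^sup>2 + (y4 - y2)\<^sup>2) + 4 * n"
    unfolding on2(2) on2(4) by (simp add: power2_eq_square algebra_simps)
  then have 2: "n / l + 1 / (4 * l\<^sup>2) = 1 / (2 * k * l) - (x4 - x2)\<^sup>2 / 4"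
    unfolding sx sy dx using k l by (simp add: field_simps power2_eq_square)
  have "g / (2 * k * l) - m / k - 1 / (4 * k\<^sup>2) = g / (2 * l * k) - n / l - 1 / (4 * l\<^sup>2)"
    using 1 2 by (simp add: mult.commute mult.left_commute)
  then show ?thesis by (simp only: radius2_def sw.radius2_def sw_E sw_g)
qed

text \<open>By \<open>dist\<close> and \<open>perp\<close> every zero of \<open>L\<close> is a point
  where the circle touches the first parabola. The signs of \<open>L\<close> at the vertices give a
  zero on each of the two sides by the intermediate value theorem.\<close>

lemma perpendicular_imp_tangent_circle:
  assumes "k * (x2 + x4) = 1"
  shows "radius2 > 0" "tangent_curves (sphere centre (sqrt radius2)) (crv ` {x1..x2})"
    "tangent_curves (sphere centre (sqrt radius2)) (crv ` {x3..x4})"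
proof -
  define L where "L t = k * t\<^sup>2 + m - g * t + 1 / (2 * k) - g / (2 * l)" for t
  have dist: "(dist centre (crv t))\<^sup>2 = E * (L t)\<^sup>2 + radius2" for t
    unfolding centre_def dist_crv radius2_def L_def using k l
    by (simp add: field_simps power2_eq_square)
  have perp: "(crv t - centre) \<bullet> (e1 + (2 * k * t) *\<^sub>R e2) = E * (L t * (2 * k * t - g))" for t
    unfolding centre_def dist_crv L_def using k l by (simp add: field_simps power2_eq_square)
  \<comment> \<open>The two brackets are equations of the lines through opposite vertices: by
    \<open>U\<close> the first vanishes at the first and third vertex, by \<open>W\<close> the
    second at the second and fourth.\<close>
  have L2: "2 * L x = (1 - g) * (x + y + 1 / (2 * k) + 1 / (2 * l))
      + (1 + g) * (y - x + 1 / (2 * k) - 1 / (2 * l))" if "y = k * x\<^sup>2 + m" for x y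
    unfolding that L_def using k l by (simp add: field_simps)
  have sx: "x2 + x4 = 1 / k" and sy: "y2 + y4 = 1 / l"
    using assms perpendicular_swap[OF assms] k l by (simp_all add: field_simps)
  then have sx': "x1 + x3 = - (1 / k)" and sy': "y1 + y3 = - (1 / l)"
    using sum_x sum_y by linarith+
  have d: "y4 - y2 = x4 - x2" "y3 - y1 = - (x3 - x1)" using y_diff assms by simp_all
  define p q where "p = 1 / k" and "q = 1 / l"
  have half: "1 / (2 * k) = p / 2" "1 / (2 * l) = q / 2" by (simp_all add: p_def q_def)
  have U: "x1 + y1 + 1 / (2 * k) + 1 / (2 * l) = 0" "x3 + y3 + 1 / (2 * k) + 1 / (2 * l) = 0"
    using sx' sy' d(2) unfolding half p_def[symmetric] q_def[symmetric] by linarith+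
  have W: "y2 - x2 + 1 / (2 * k) - 1 / (2 * l) = 0" "y4 - x4 + 1 / (2 * k) - 1 / (2 * l) = 0"
    using sx sy d(1) unfolding half p_def[symmetric] q_def[symmetric] by linarith+
  have "2 * L x1 = (1 + g) * (y1 - x1 + 1 / (2 * k) - 1 / (2 * l))" using L2[OF on1(1)] U by simp
  moreover have "y1 - x1 + 1 / (2 * k) - 1 / (2 * l) > 0" using W x_less y_less by linarith
  ultimately have L1: "L x1 > 0" using g_bounds mult_pos_pos[of "1 + g"] by (smt (verit))
  have "2 * L x3 = (1 + g) * (y3 - x3 + 1 / (2 * k) - 1 / (2 * l))" using L2[OF on1(3)] U by simp
  moreover have "y3 - x3 + 1 / (2 * k) - 1 / (2 * l) < 0" using W x_less y_less by linarith
  ultimately have L3: "L x3 < 0" using g_bounds mult_pos_neg[of "1 + g"] by (smt (verit))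
  \<comment> \<open>As \<open>x2 < x3\<close>, the chord from the first to the second vertex has
    slope below -1, the slope of the diagonal through the first vertex. So the second vertex lies
    below that diagonal.\<close>
  have "k * (- (x1 + x2)) > k * (- (x1 + x3))" using x_less k by simp
  then have "k * (- (x1 + x2)) > 1" using sx' k by simp
  then have "1 * (x2 - x1) < k * (- (x1 + x2)) * (x2 - x1)"
    using x_less by (intro mult_strict_right_mono) auto
  also have "\<dots> = y1 - y2"
    unfolding on1(1) on1(2) by (simp add: power2_eq_square algebra_simps)
  finally have "x2 - x1 < y1 - y2" by simp
  then have "x2 + y2 + 1 / (2 * k) + 1 / (2 * l) < 0" using U by linarith
  moreover have "2 * L x2 = (1 - g) * (x2 + y2 + 1 / (2 * k) + 1 / (2 * l))"
    using L2[OF on1(2)] W by simp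
  ultimately have L2': "L x2 < 0" using g_bounds mult_pos_neg[of "1 - g"] by (smt (verit))
  have "2 * L x4 = (1 - g) * (x4 + y4 + 1 / (2 * k) + 1 / (2 * l))"
    using L2[OF on1(4)] W by simp
  moreover have "x4 + y4 + 1 / (2 * k) + 1 / (2 * l) > 0" using U x_less y_less by linarith
  ultimately have L4: "L x4 > 0" using g_bounds mult_pos_pos[of "1 - g"] by (smt (verit))
  have cont: "continuous_on S L" for S unfolding L_def by (intro continuous_intros) (use k l in auto)
  obtain \<alpha> where \<alpha>: "x1 \<le> \<alpha>" "\<alpha> \<le> x2" "L \<alpha> = 0"
    using IVT2'[of L x2 0 x1] L1 L2' x_less cont by auto
  obtain \<beta> where \<beta>: "x3 \<le> \<beta>" "\<beta> \<le> x4" "L \<beta> = 0"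
    using IVT'[of L x3 0 x4] L3 L4 x_less cont by auto
  have r: "(dist centre (crv \<alpha>))\<^sup>2 = radius2" "(dist centre (crv \<beta>))\<^sup>2 = radius2"
    by (simp_all add: dist \<alpha> \<beta>)
  \<comment> \<open>A zero radius would place both points of contact at the centre, but their
    parameters differ.\<close>
  have "radius2 \<noteq> 0"
  proof
    assume "radius2 = 0"
    then have "centre = crv \<alpha>" "centre = crv \<beta>" using r by simp_all
    then have "crv \<alpha> = crv \<beta>" by simp
    then show False using \<alpha> \<beta> x_less by simp
  qed
  then show pos: "radius2 > 0" using r(1) by (metis antisym_conv1 zero_le_power2)
  have r': "dist centre (crv \<alpha>) = sqrt radius2" "dist centre (crv \<beta>) = sqrt radius2"
    using r by (metis real_sqrt_unique zero_le_dist)+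
  have "(crv \<alpha> - centre) \<bullet> (e1 + (2 * k * \<alpha>) *\<^sub>R e2) = 0"
    "(crv \<beta> - centre) \<bullet> (e1 + (2 * k * \<beta>) *\<^sub>R e2) = 0" by (simp_all only: perp \<alpha> \<beta> mult_zero_left mult_zero_right)
  then show "tangent_curves (sphere centre (sqrt radius2)) (crv ` {x1..x2})"
    "tangent_curves (sphere centre (sqrt radius2)) (crv ` {x3..x4})"
    using r' \<alpha> \<beta> pos x_less
    by (simp_all only: tangent_circle_crv_iff real_sqrt_gt_0_iff) (meson atLeastAtMost_iff)+
qed

end

context parabolic_quadrilateral
begin

text \<open>For the sides on the second parabola the circle comes from the exchanged coordinates,
  where centre and radius are the same.\<close>

lemma tangent_circle_iff_perpendicular:
  "(\<exists>c r. r > 0 \<and> (\<forall>S \<in> pq_sides F1 d1 F2 d2. tangent_curves (sphere c r) S)) \<longleftrightarrow>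
   (\<exists>A B C D. pq_diagonals F1 d1 F2 d2 = {closed_segment A C, closed_segment B D} \<and>
      closed_segment A C \<noteq> closed_segment B D \<and> orthogonal (C - A) (D - B))"
  unfolding perpendicular_diagonals_iff orthogonal_diagonals_iff
proof
  assume "\<exists>c r. r > 0 \<and> (\<forall>S \<in> pq_sides F1 d1 F2 d2. tangent_curves (sphere c r) S)"
  then show "k * (x2 + x4) = 1" using tangent_circle_imp_perpendicular by blast
next
  assume s: "k * (x2 + x4) = 1"
  note T = perpendicular_imp_tangent_circle[OF s]
  have "tangent_curves (sphere centre (sqrt radius2)) (sw.crv ` {y3..y2})"
    "tangent_curves (sphere centre (sqrt radius2)) (sw.crv ` {y1..y4})"
    using sw.perpendicular_imp_tangent_circle[OF perpendicular_swap[OF s]]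
    unfolding sw_centre sw_radius2[OF s] by simp_all
  with T show "\<exists>c r. r > 0 \<and> (\<forall>S \<in> pq_sides F1 d1 F2 d2. tangent_curves (sphere c r) S)"
    unfolding sides by (intro exI[of _ centre] exI[of _ "sqrt radius2"]) simp
qed

end

section \<open>Existence of adapted coordinates\<close>

lemma card_quadratic_zeros_le: "card {x::real. a * x\<^sup>2 + b * x + c = 0} \<le> 2"
proof -
  have eq: "{x. a * x\<^sup>2 + b * x + c = 0} = {x. poly [:c, b, a:] x = 0}"
    by (simp add: power2_eq_square algebra_simps)
  show ?thesis
  proof (cases "[:c, b, a:] = 0")
    case True
    \<comment> \<open>Here every real is a zero, and \<open>card\<close> of an infinite set is
      0.\<close>
    then show ?thesis unfolding eq by (simp add: infinite_UNIV_char_0)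
  next
    case False
    have "card {x. poly [:c, b, a:] x = 0} \<le> degree [:c, b, a:]"
      using False by (rule card_poly_roots_bound)
    also have "\<dots> \<le> 2" by simp
    finally show ?thesis unfolding eq .
  qed
qed

lemma card_4_sorted:
  fixes S :: "real set"
  assumes "card S = 4"
  obtains a b c d where "S = {a, b, c, d}" "a < b" "b < c" "c < d"
proof -
  have fin: "finite S" using assms by (metis card.infinite zero_neq_numeral)
  have "length (sorted_list_of_set S) = Suc (Suc (Suc (Suc 0)))" using assms by simp
  then obtain a b c d where xs: "sorted_list_of_set S = [a, b, c, d]"
    unfolding length_Suc_conv by auto
  have "S = set [a, b, c, d]" unfolding xs[symmetric] using fin by simp
  moreover have "sorted_wrt (<) [a, b, c, d]"
    unfolding xs[symmetric] by (rule strict_sorted_list_of_set)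
  ultimately show thesis using that by simp
qed

text \<open>If the axes were parallel, the first parabola would be a graph over the direction
  orthogonal to them, and substitution into the second would leave an equation
  \<open>q \<xi> = 0\<close> of degree at most 2.\<close>

lemma parabolas_not_parallel:
  assumes u: "norm u1 = 1" "norm u2 = 1" and h: "h1 > 0" "h2 > 0"
    and "card ({X. (perp u1 \<bullet> (X - V1))\<^sup>2 = 2 * h1 * (u1 \<bullet> (X - V1))} \<inter>
      {X. (perp u2 \<bullet> (X - V2))\<^sup>2 = 2 * h2 * (u2 \<bullet> (X - V2))}) = 4" (is "card ?S = 4")
  shows "perp u2 \<bullet> u1 \<noteq> 0"
proof
  assume par: "perp u2 \<bullet> u1 = 0"
  define w where "w = perp u1"
  \<comment> \<open>For parallel axes this is 1 or -1, according to whether the parabolas open in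
    the same or in opposite directions.\<close>
  define \<tau> where "\<tau> = u1 \<bullet> u2"
  have uu: "u1$1 * u1$1 + u1$2 * u1$2 = 1" using u(1) by (simp add: norm_eq_1 inner_point)
  have "u2$1 = \<tau> * u1$1" "u2$2 = \<tau> * u1$2"
    using uu par by (simp_all add: \<tau>_def inner_point) algebra+
  then have u2: "u2 = \<tau> *\<^sub>R u1" by (simp add: point_eq_iff)
  have "\<bar>\<tau>\<bar> = 1" using u by (simp add: u2)
  then have \<tau>: "\<tau>\<^sup>2 = 1" by (metis abs_power2 one_power2 power2_abs)
  have pu2: "(perp u2 \<bullet> Z)\<^sup>2 = (w \<bullet> Z)\<^sup>2" for Z
  proof -
    have "perp u2 \<bullet> Z = \<tau> * (w \<bullet> Z)" by (simp add: u2 w_def inner_point algebra_simps)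
    then show ?thesis by (simp add: power_mult_distrib \<tau>)
  qed
  have on: "w \<bullet> w = 1" "u1 \<bullet> u1 = 1" "w \<bullet> u1 = 0" "u1 \<bullet> w = 0"
    using uu by (simp_all add: w_def inner_point algebra_simps)
  have rep: "(w \<bullet> X) *\<^sub>R w + (u1 \<bullet> X) *\<^sub>R u1 = X" for X
    unfolding point_eq_iff using uu by (simp add: w_def inner_point) algebra
  define s where "s = 1 / (2 * h1)"
  define v where "v \<xi> = s * (\<xi> - w \<bullet> V1)\<^sup>2 + u1 \<bullet> V1" for \<xi>
  define f where "f \<xi> = \<xi> *\<^sub>R w + v \<xi> *\<^sub>R u1" for \<xi>
  define q where "q \<xi> = (\<xi> - w \<bullet> V2)\<^sup>2 - 2 * h2 * (\<tau> * (v \<xi> - u1 \<bullet> V2))" for \<xi>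
  have wf: "w \<bullet> f \<xi> = \<xi>" and uf: "u1 \<bullet> f \<xi> = v \<xi>" for \<xi>
    by (simp_all add: f_def inner_add_right on)
  have f1: "(w \<bullet> (X - V1))\<^sup>2 = 2 * h1 * (u1 \<bullet> (X - V1)) \<longleftrightarrow> u1 \<bullet> X = v (w \<bullet> X)" for X
    using h(1) by (auto simp: v_def s_def inner_diff_right field_simps)
  have f2: "f \<xi> \<in> {X. (perp u2 \<bullet> (X - V2))\<^sup>2 = 2 * h2 * (u2 \<bullet> (X - V2))} \<longleftrightarrow> q \<xi> = 0" for \<xi>
  proof -
    have "w \<bullet> (f \<xi> - V2) = \<xi> - w \<bullet> V2" "u2 \<bullet> (f \<xi> - V2) = \<tau> * (v \<xi> - u1 \<bullet> V2)"
      by (simp_all only: u2 inner_diff_right inner_scaleR_left wf uf right_diff_distrib)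
    then show ?thesis unfolding mem_Collect_eq pu2 q_def by simp
  qed
  have S: "?S = f ` {\<xi>. q \<xi> = 0}"
  proof (intro set_eqI iffI)
    fix X assume X: "X \<in> ?S"
    then have uX: "u1 \<bullet> X = v (w \<bullet> X)" unfolding Int_iff mem_Collect_eq w_def[symmetric] f1 by blast
    have fX: "f (w \<bullet> X) = X" unfolding f_def uX[symmetric] by (rule rep)
    have "f (w \<bullet> X) \<in> {X. (perp u2 \<bullet> (X - V2))\<^sup>2 = 2 * h2 * (u2 \<bullet> (X - V2))}"
      unfolding fX using X by blast
    then have "w \<bullet> X \<in> {\<xi>. q \<xi> = 0}" unfolding f2 by blast
    then show "X \<in> f ` {\<xi>. q \<xi> = 0}" using fX by (metis imageI)
  next
    fix X assume "X \<in> f ` {\<xi>. q \<xi> = 0}"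
    then obtain \<xi> where \<xi>: "X = f \<xi>" "q \<xi> = 0" by blast
    have "f \<xi> \<in> {X. (perp u1 \<bullet> (X - V1))\<^sup>2 = 2 * h1 * (u1 \<bullet> (X - V1))}"
      unfolding mem_Collect_eq w_def[symmetric] f1 wf uf ..
    then show "X \<in> ?S" using f2[of \<xi>] \<xi> by blast
  qed
  have "card (f ` {\<xi>. q \<xi> = 0}) = card {\<xi>. q \<xi> = 0}"
    by (intro card_image inj_on_inverseI[of _ "\<lambda>X. w \<bullet> X"]) (simp add: wf)
  then have "card {\<xi>. q \<xi> = 0} = 4" using assms(5) unfolding S by simp
  moreover have quad: "q \<xi> = (1 - 2 * h2 * \<tau> * s) * \<xi>\<^sup>2
      + (4 * h2 * \<tau> * s * (w \<bullet> V1) - 2 * (w \<bullet> V2)) * \<xi>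
      + ((w \<bullet> V2)\<^sup>2 - 2 * h2 * \<tau> * (s * (w \<bullet> V1)\<^sup>2 + u1 \<bullet> V1 - u1 \<bullet> V2))" for \<xi>
    unfolding q_def v_def by (simp add: power2_eq_square algebra_simps)
  have "card {\<xi>. q \<xi> = 0} \<le> 2" unfolding quad by (rule card_quadratic_zeros_le)
  ultimately show False by simp
qed

text \<open>Expressing \<open>u\<close> through \<open>w\<close> and \<open>w'\<close> turns the
  equation into one in the oblique coordinates \<open>w \<bullet> X\<close> and
  \<open>w' \<bullet> X\<close>. The shift \<open>a\<close> absorbs the linear term in
  \<open>w \<bullet> X\<close>.\<close>

lemma parabola_complete_square:
  fixes u w w' V :: point
  assumes "h > 0" "D > 0" and u: "D *\<^sub>R u = w' - \<kappa> *\<^sub>R w"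
  obtains k a m where "k > 0"
    "\<forall>X. (w \<bullet> (X - V))\<^sup>2 \<le> 2 * h * (u \<bullet> (X - V)) \<longleftrightarrow> k * (w \<bullet> X - a)\<^sup>2 + m \<le> w' \<bullet> X"
    "\<forall>X. (w \<bullet> (X - V))\<^sup>2 = 2 * h * (u \<bullet> (X - V)) \<longleftrightarrow> w' \<bullet> X = k * (w \<bullet> X - a)\<^sup>2 + m"
proof -
  define k where "k = D / (2 * h)"
  define a where "a = w \<bullet> V - h * \<kappa> / D"
  define m where "m = w' \<bullet> V - k * (h * \<kappa> / D)\<^sup>2"
  have k: "k > 0" using assms by (simp add: k_def)
  have "k * (w \<bullet> X - a)\<^sup>2 + m - w' \<bullet> X = k * ((w \<bullet> (X - V))\<^sup>2 - 2 * h * (u \<bullet> (X - V)))" for X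
  proof -
    have "D * (u \<bullet> (X - V)) = w' \<bullet> (X - V) - \<kappa> * (w \<bullet> (X - V))"
      using arg_cong[OF u, of "\<lambda>z. z \<bullet> (X - V)"] by (simp add: inner_diff_left)
    then have uX: "u \<bullet> (X - V) = (w' \<bullet> (X - V) - \<kappa> * (w \<bullet> (X - V))) / D"
      using assms by (simp add: field_simps)
    have wX: "w \<bullet> X - a = w \<bullet> (X - V) + h * \<kappa> / D"
      and w'X: "w' \<bullet> X = w' \<bullet> (X - V) + m + k * (h * \<kappa> / D)\<^sup>2"
      by (simp_all add: a_def m_def inner_diff_right)
    show ?thesis
      unfolding wX w'X uX k_def using assms by (simp add: field_simps power2_eq_square)
  qed
  then have *: "k * (w \<bullet> X - a)\<^sup>2 + m - w' \<bullet> X \<le> 0 \<longleftrightarrow> (w \<bullet> (X - V))\<^sup>2 - 2 * h * (u \<bullet> (X - V)) \<le> 0"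
    "k * (w \<bullet> X - a)\<^sup>2 + m - w' \<bullet> X = 0 \<longleftrightarrow> (w \<bullet> (X - V))\<^sup>2 - 2 * h * (u \<bullet> (X - V)) = 0" for X
    using k by (simp_all add: mult_le_0_iff)
  show thesis
  proof (rule that[OF k]; rule allI)
    show "(w \<bullet> (X - V))\<^sup>2 \<le> 2 * h * (u \<bullet> (X - V)) \<longleftrightarrow> k * (w \<bullet> X - a)\<^sup>2 + m \<le> w' \<bullet> X" for X
      using *(1)[of X] by linarith
    show "(w \<bullet> (X - V))\<^sup>2 = 2 * h * (u \<bullet> (X - V)) \<longleftrightarrow> w' \<bullet> X = k * (w \<bullet> X - a)\<^sup>2 + m" for X
      using *(2)[of X] by linarith
  qed
qed

theorem mainTheorem1:
  fixes F1 F2 :: point and d1 d2 :: "point set"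
  assumes "is_line d1" and "F1 \<notin> d1"
    and "is_line d2" and "F2 \<notin> d2"
    and "card (parabola F1 d1 \<inter> parabola F2 d2) = 4"
  shows "(\<exists>c r. r > 0 \<and> (\<forall>S \<in> pq_sides F1 d1 F2 d2. tangent_curves (sphere c r) S))
     \<longleftrightarrow>
     (\<exists>A B C D. pq_diagonals F1 d1 F2 d2 = {closed_segment A C, closed_segment B D} \<and>
        closed_segment A C \<noteq> closed_segment B D \<and> orthogonal (C - A) (D - B))"
proof -
  obtain u1 V1 h1 where u1: "norm u1 = 1" and h1: "h1 > 0"
    and reg1: "parabolic_region F1 d1 = {X. (perp u1 \<bullet> (X - V1))\<^sup>2 \<le> 2 * h1 * (u1 \<bullet> (X - V1))}"
    and par1: "parabola F1 d1 = {X. (perp u1 \<bullet> (X - V1))\<^sup>2 = 2 * h1 * (u1 \<bullet> (X - V1))}"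
    by (rule parabola_normal_form[OF assms(1,2)])
  obtain u2 V2 h2 where u2: "norm u2 = 1" and h2: "h2 > 0"
    and reg2: "parabolic_region F2 d2 = {X. (perp u2 \<bullet> (X - V2))\<^sup>2 \<le> 2 * h2 * (u2 \<bullet> (X - V2))}"
    and par2: "parabola F2 d2 = {X. (perp u2 \<bullet> (X - V2))\<^sup>2 = 2 * h2 * (u2 \<bullet> (X - V2))}"
    by (rule parabola_normal_form[OF assms(3,4)])
  have uu1: "u1$1 * u1$1 + u1$2 * u1$2 = 1" and uu2: "u2$1 * u2$1 + u2$2 * u2$2 = 1"
    using u1 u2 by (simp_all add: norm_eq_1 inner_point)
  have "perp u2 \<bullet> u1 \<noteq> 0"
    using parabolas_not_parallel[OF u1 u2 h1 h2] assms(5) unfolding par1 par2 .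
  \<comment> \<open>With this sign \<open>w1 \<bullet> u2\<close> and \<open>w2 \<bullet> u1\<close>
    both equal \<open>D > 0\<close>, so both parabolas open in the positive coordinate
    directions.\<close>
  define \<sigma> where "\<sigma> = sgn (perp u2 \<bullet> u1)"
  define D where "D = \<bar>perp u2 \<bullet> u1\<bar>"
  define w1 where "w1 = (- \<sigma>) *\<^sub>R perp u1"
  define w2 where "w2 = \<sigma> *\<^sub>R perp u2"
  have D: "D > 0" and \<sigma>: "\<sigma> * \<sigma> = 1" and D': "D = \<sigma> * (perp u2 \<bullet> u1)"
    using \<open>perp u2 \<bullet> u1 \<noteq> 0\<close> by (auto simp: D_def \<sigma>_def sgn_if)
  have wp: "(perp u1 \<bullet> Z)\<^sup>2 = (w1 \<bullet> Z)\<^sup>2" "(perp u2 \<bullet> Z)\<^sup>2 = (w2 \<bullet> Z)\<^sup>2" for Z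
    using \<sigma> by (simp_all add: w1_def w2_def power_mult_distrib power2_eq_square[of \<sigma>])
  have DE: "D = \<sigma> * (u1$2 * u2$1 - u1$1 * u2$2)" unfolding D' by (simp add: inner_point)
  \<comment> \<open>Each right-hand side is the component of one unit normal orthogonal to the
    other.\<close>
  have Du: "D *\<^sub>R u1 = w2 - (w1 \<bullet> w2) *\<^sub>R w1" "D *\<^sub>R u2 = w1 - (w1 \<bullet> w2) *\<^sub>R w2"
    unfolding point_eq_iff DE w1_def w2_def inner_point using \<sigma> uu1 uu2 by (simp; algebra)+
  obtain k a m where k: "k > 0"
    "\<forall>X. (w1 \<bullet> (X - V1))\<^sup>2 \<le> 2 * h1 * (u1 \<bullet> (X - V1)) \<longleftrightarrow> k * (w1 \<bullet> X - a)\<^sup>2 + m \<le> w2 \<bullet> X"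
    "\<forall>X. (w1 \<bullet> (X - V1))\<^sup>2 = 2 * h1 * (u1 \<bullet> (X - V1)) \<longleftrightarrow> w2 \<bullet> X = k * (w1 \<bullet> X - a)\<^sup>2 + m"
    by (rule parabola_complete_square[OF h1 D Du(1), of V1])
  obtain l b n where l: "l > 0"
    "\<forall>X. (w2 \<bullet> (X - V2))\<^sup>2 \<le> 2 * h2 * (u2 \<bullet> (X - V2)) \<longleftrightarrow> l * (w2 \<bullet> X - b)\<^sup>2 + n \<le> w1 \<bullet> X"
    "\<forall>X. (w2 \<bullet> (X - V2))\<^sup>2 = 2 * h2 * (u2 \<bullet> (X - V2)) \<longleftrightarrow> w1 \<bullet> X = l * (w2 \<bullet> X - b)\<^sup>2 + n"
    by (rule parabola_complete_square[OF h2 D Du(2), of V2])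
  \<comment> \<open>The basis dual to \<open>w1\<close>, \<open>w2\<close>. Its vectors have equal
    length because \<open>u1\<close> and \<open>u2\<close> are unit vectors.\<close>
  define e1 where "e1 = (1 / D) *\<^sub>R u2"
  define e2 where "e2 = (1 / D) *\<^sub>R u1"
  \<comment> \<open>This origin removes the shifts \<open>a\<close> and \<open>b\<close> from the
    squares; they move into the constants \<open>m - b\<close> and \<open>n - a\<close>.\<close>
  define org where "org = a *\<^sub>R e1 + b *\<^sub>R e2"
  have "w1 \<bullet> u2 = D" "w1 \<bullet> u1 = 0" "w2 \<bullet> u2 = 0" "w2 \<bullet> u1 = D"
    unfolding DE w1_def w2_def by (simp_all add: inner_point algebra_simps)
  then have dual: "w1 \<bullet> e1 = 1" "w1 \<bullet> e2 = 0" "w2 \<bullet> e1 = 0" "w2 \<bullet> e2 = 1"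
    using D by (simp_all add: e1_def e2_def)
  have DX: "D *\<^sub>R X = (w1 \<bullet> X) *\<^sub>R u2 + (w2 \<bullet> X) *\<^sub>R u1" for X
    unfolding point_eq_iff DE w1_def w2_def by (simp add: inner_point algebra_simps)
  have rep: "X = (w1 \<bullet> X) *\<^sub>R e1 + (w2 \<bullet> X) *\<^sub>R e2" for X
  proof -
    have "X = (1 / D) *\<^sub>R (D *\<^sub>R X)" using D by simp
    also have "\<dots> = (w1 \<bullet> X) *\<^sub>R e1 + (w2 \<bullet> X) *\<^sub>R e2"
      unfolding DX[of X] by (simp add: e1_def e2_def scaleR_add_right)
    finally show ?thesis .
  qed
  have coord: "w1 \<bullet> (org + x *\<^sub>R e1 + y *\<^sub>R e2) = a + x" "w2 \<bullet> (org + x *\<^sub>R e1 + y *\<^sub>R e2) = b + y" for x y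
    by (simp_all add: org_def inner_add_right dual)
  have in_reg1: "org + x *\<^sub>R e1 + y *\<^sub>R e2 \<in> parabolic_region F1 d1 \<longleftrightarrow> k * x\<^sup>2 + (m - b) \<le> y"
    and in_par1: "org + x *\<^sub>R e1 + y *\<^sub>R e2 \<in> parabola F1 d1 \<longleftrightarrow> y = k * x\<^sup>2 + (m - b)"
    and in_reg2: "org + x *\<^sub>R e1 + y *\<^sub>R e2 \<in> parabolic_region F2 d2 \<longleftrightarrow> l * y\<^sup>2 + (n - a) \<le> x"
    and in_par2: "org + x *\<^sub>R e1 + y *\<^sub>R e2 \<in> parabola F2 d2 \<longleftrightarrow> x = l * y\<^sup>2 + (n - a)" for x y
    unfolding reg1 par1 reg2 par2 wp mem_Collect_eq k(2,3)[rule_format] l(2,3)[rule_format] coord by auto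
  define f where "f x = org + x *\<^sub>R e1 + (k * x\<^sup>2 + (m - b)) *\<^sub>R e2" for x
  define Q where "Q = {x. x = l * (k * x\<^sup>2 + (m - b))\<^sup>2 + (n - a)}"
  have wf: "w1 \<bullet> f x = a + x" for x by (simp add: f_def coord)
  have S: "parabola F1 d1 \<inter> parabola F2 d2 = f ` Q"
  proof (intro set_eqI iffI)
    fix X assume X: "X \<in> parabola F1 d1 \<inter> parabola F2 d2"
    define x y where "x = w1 \<bullet> (X - org)" and "y = w2 \<bullet> (X - org)"
    have "X = org + (X - org)" by simp
    also have "\<dots> = org + (x *\<^sub>R e1 + y *\<^sub>R e2)" unfolding x_def y_def by (rule arg_cong[OF rep])
    finally have X': "X = org + x *\<^sub>R e1 + y *\<^sub>R e2" by (simp only: add.assoc)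
    have y: "y = k * x\<^sup>2 + (m - b)" and x: "x = l * y\<^sup>2 + (n - a)"
      using X unfolding X' Int_iff in_par1 in_par2 by blast+
    have "X = f x" unfolding X' f_def by (simp only: y[symmetric])
    moreover have "x \<in> Q" unfolding Q_def mem_Collect_eq y[symmetric] by (rule x)
    ultimately show "X \<in> f ` Q" by blast
  next
    fix X assume "X \<in> f ` Q"
    then show "X \<in> parabola F1 d1 \<inter> parabola F2 d2" by (auto simp: f_def Q_def in_par1 in_par2)
  qed
  have "card (f ` Q) = card Q"
    by (intro card_image inj_on_inverseI[of _ "\<lambda>X. w1 \<bullet> X - a"]) (simp add: wf)
  then have "card Q = 4" using assms(5) unfolding S by simp
  then obtain x1 x2 x3 x4 where Q': "Q = {x1, x2, x3, x4}" and less: "x1 < x2" "x2 < x3" "x3 < x4"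
    by (rule card_4_sorted)
  have on: "x = l * (k * x\<^sup>2 + (m - b))\<^sup>2 + (n - a)" if "x \<in> {x1, x2, x3, x4}" for x
    using that unfolding Q'[symmetric] Q_def by blast
  interpret parabolic_quadrilateral F1 d1 F2 d2 org w1 w2 e1 e2 k l "m - b" "n - a" x1 x2 x3 x4
    "k * x1\<^sup>2 + (m - b)" "k * x2\<^sup>2 + (m - b)" "k * x3\<^sup>2 + (m - b)" "k * x4\<^sup>2 + (m - b)"
  proof
    show "e1 \<bullet> e1 = e2 \<bullet> e2" using u1 u2 by (simp add: e1_def e2_def norm_eq_1)
  qed (rule k(1) l(1) dual rep in_par1 in_par2 in_reg1 in_reg2 less refl on; simp)+
  show ?thesis by (rule tangent_circle_iff_perpendicular)
qed

end
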